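(* Let $A$ be a unital AF algebra, and let $\alpha \in \mathrm{Aut}(A)$ be an automorphism which satisfies $\alpha^n = \mathrm{id}_A$ and such that the action of $\mathbf{Z}_n = \mathbf{Z}/n\mathbf{Z}$ generated by $\alpha$ has the strict Rokhlin property. Then the crossed product $C^*(\mathbf{Z}_n, A, \alpha)$ is an AF algebra.
   Context: Strict Rokhlin property: let $A$ be a unital C*-algebra and let $\alpha \in \mathrm{Aut}(A)$ satisfy $\alpha^n = \mathrm{id}_A$. The action of $\mathbf{Z}_n$ generated by $\alpha$ has the strict Rokhlin property if for every finite set $F \subset A$ and every $\varepsilon > 0$ there are mutually orthogonal projections $e_0, e_1, \dots, e_{n-1} \in A$ such that: (1) $\| \alpha(e_j) - e_{j+1} \| < \varepsilon$ for $0 \le j \le n-2$; (2) $\| e_j a - a e_j \| < \varepsilon$ for $0 \le j \le n-1$ and all $a \in F$; (3) $\sum_{j=0}^{n-1} e_j = 1$. $C^*(\mathbf{Z}_n, A, \alpha)$ denotes the crossed product of $A$ by the action of $\mathbf{Z}_n$ generated by $\alpha$. *)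

theory Defs
  imports "HOL-Analysis.Analysis"
begin

section \<open>Unital C*-algebras\<close>

text \<open>
  The norm axiom \<open>norm 1 = 1\<close> and the axiom \<open>0 \<noteq> 1\<close> are left out so that the zero algebra counts
  as a unital C*-algebra. In every other algebra they follow from the C*-identity.
\<close>

class cstar_algebra = banach + real_normed_algebra + monoid_mult +
  fixes scaleC :: "complex \<Rightarrow> 'a \<Rightarrow> 'a" (infixr \<open>*\<^sub>C\<close> 75)
    and star :: "'a \<Rightarrow> 'a"
  assumes scaleC_of_real: "complex_of_real r *\<^sub>C a = r *\<^sub>R a"
    and scaleC_add_right: "c *\<^sub>C (a + b) = c *\<^sub>C a + c *\<^sub>C b"
    and scaleC_add_left: "(c + d) *\<^sub>C a = c *\<^sub>C a + d *\<^sub>C a"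
    and scaleC_scaleC: "c *\<^sub>C d *\<^sub>C a = (c * d) *\<^sub>C a"
    and mult_scaleC_left: "(c *\<^sub>C a) * b = c *\<^sub>C (a * b)"
    and mult_scaleC_right: "a * (c *\<^sub>C b) = c *\<^sub>C (a * b)"
    and norm_scaleC: "norm (c *\<^sub>C a) = cmod c * norm a"
    and star_star: "star (star a) = a"
    and star_add: "star (a + b) = star a + star b"
    and star_scaleC: "star (c *\<^sub>C a) = cnj c *\<^sub>C star a"
    and star_mult: "star (a * b) = star b * star a"
    and cstar_identity: "norm (star a * a) = (norm a)\<^sup>2"

global_interpretation complex_space: vector_space "scaleC :: complex \<Rightarrow> 'a \<Rightarrow> 'a::cstar_algebra"
  defines cspan = complex_space.span
    and csubspace = complex_space.subspace
proof unfold_locales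
  show "1 *\<^sub>C x = x" for x :: 'a
    using scaleC_of_real[of 1 x] by simp
qed (simp_all add: scaleC_add_right scaleC_add_left scaleC_scaleC)

instantiation complex :: cstar_algebra
begin
definition "scaleC_complex = (times :: complex \<Rightarrow> complex \<Rightarrow> complex)"
definition "star_complex = cnj"
instance
  by standard
    (simp_all add: scaleC_complex_def star_complex_def scaleR_conv_of_real algebra_simps
      norm_mult power2_eq_square)
end

definition star_automorphism :: "('a::cstar_algebra \<Rightarrow> 'a) \<Rightarrow> bool" where
  "star_automorphism \<alpha> \<longleftrightarrow> bij \<alpha> \<and>
    (\<forall>a b. \<alpha> (a + b) = \<alpha> a + \<alpha> b) \<and>
    (\<forall>c a. \<alpha> (c *\<^sub>C a) = c *\<^sub>C \<alpha> a) \<and>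
    (\<forall>a b. \<alpha> (a * b) = \<alpha> a * \<alpha> b) \<and>
    (\<forall>a. \<alpha> (star a) = star (\<alpha> a))"

definition projection :: "'a::cstar_algebra \<Rightarrow> bool" where
  "projection e \<longleftrightarrow> star e = e \<and> e * e = e"


section \<open>AF algebras\<close>

text \<open>A finite-dimensional *-subalgebra is automatically norm closed, hence a C*-subalgebra. It need
  not contain the unit of the ambient algebra.\<close>

definition findim_star_subalgebra :: "'a::cstar_algebra set \<Rightarrow> bool" where
  "findim_star_subalgebra B \<longleftrightarrow>
    csubspace B \<and> (\<exists>S. finite S \<and> B = cspan S) \<and>
    (\<forall>a\<in>B. \<forall>b\<in>B. a * b \<in> B) \<and> (\<forall>a\<in>B. star a \<in> B)"

definition AF_algebra :: "'a::cstar_algebra itself \<Rightarrow> bool" where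
  "AF_algebra _ \<longleftrightarrow> (\<exists>B :: nat \<Rightarrow> 'a set.
    (\<forall>k. findim_star_subalgebra (B k)) \<and>
    (\<forall>k. B k \<subseteq> B (Suc k)) \<and>
    closure (\<Union>k. B k) = UNIV)"


section \<open>The strict Rokhlin property\<close>

definition strict_Rokhlin :: "nat \<Rightarrow> ('a::cstar_algebra \<Rightarrow> 'a) \<Rightarrow> bool" where
  "strict_Rokhlin n \<alpha> \<longleftrightarrow> (\<forall>F :: 'a set. \<forall>\<epsilon>::real. finite F \<and> \<epsilon> > 0 \<longrightarrow>
    (\<exists>e :: nat \<Rightarrow> 'a.
      (\<forall>j<n. projection (e j)) \<and>
      (\<forall>i<n. \<forall>j<n. i \<noteq> j \<longrightarrow> e i * e j = 0) \<and>
      (\<forall>j. j + 1 < n \<longrightarrow> norm (\<alpha> (e j) - e (j + 1)) < \<epsilon>) \<and>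
      (\<forall>j<n. \<forall>a\<in>F. norm (e j * a - a * e j) < \<epsilon>) \<and>
      (\<Sum>j<n. e j) = 1))"


section \<open>Covariant representations on Hilbert space\<close>

text \<open>The Hilbert space with orthonormal basis indexed by \<open>'i\<close>; operators on it are represented by
  functions of which only the values on \<^term>\<open>ell2\<close> matter.\<close>

definition ell2 :: "('i \<Rightarrow> complex) set" where
  "ell2 = {\<xi>. (\<lambda>i. (cmod (\<xi> i))\<^sup>2) summable_on UNIV}"

definition ell2_inner :: "('i \<Rightarrow> complex) \<Rightarrow> ('i \<Rightarrow> complex) \<Rightarrow> complex" where
  "ell2_inner \<xi> \<eta> = (\<Sum>\<^sub>\<infinity>i. cnj (\<xi> i) * \<eta> i)"

definition ell2_norm :: "('i \<Rightarrow> complex) \<Rightarrow> real" where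
  "ell2_norm \<xi> = sqrt (\<Sum>\<^sub>\<infinity>i. (cmod (\<xi> i))\<^sup>2)"

definition bounded_operator :: "(('i \<Rightarrow> complex) \<Rightarrow> ('i \<Rightarrow> complex)) \<Rightarrow> bool" where
  "bounded_operator T \<longleftrightarrow>
    (\<forall>\<xi>\<in>ell2. T \<xi> \<in> ell2) \<and>
    (\<forall>\<xi>\<in>ell2. \<forall>\<eta>\<in>ell2. T (\<lambda>i. \<xi> i + \<eta> i) = (\<lambda>i. T \<xi> i + T \<eta> i)) \<and>
    (\<forall>c. \<forall>\<xi>\<in>ell2. T (\<lambda>i. c * \<xi> i) = (\<lambda>i. c * T \<xi> i)) \<and>
    (\<exists>K. \<forall>\<xi>\<in>ell2. ell2_norm (T \<xi>) \<le> K * ell2_norm \<xi>)"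

definition operator_norm :: "(('i \<Rightarrow> complex) \<Rightarrow> ('i \<Rightarrow> complex)) \<Rightarrow> real" where
  "operator_norm T = Sup {ell2_norm (T \<xi>) | \<xi>. \<xi> \<in> ell2 \<and> ell2_norm \<xi> \<le> 1}"

definition star_representation ::
    "('a::cstar_algebra \<Rightarrow> ('i \<Rightarrow> complex) \<Rightarrow> ('i \<Rightarrow> complex)) \<Rightarrow> bool" where
  "star_representation \<pi> \<longleftrightarrow>
    (\<forall>a. bounded_operator (\<pi> a)) \<and>
    (\<forall>a b. \<forall>\<xi>\<in>ell2. \<pi> (a + b) \<xi> = (\<lambda>i. \<pi> a \<xi> i + \<pi> b \<xi> i)) \<and>
    (\<forall>c a. \<forall>\<xi>\<in>ell2. \<pi> (c *\<^sub>C a) \<xi> = (\<lambda>i. c * \<pi> a \<xi> i)) \<and>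
    (\<forall>a b. \<forall>\<xi>\<in>ell2. \<pi> (a * b) \<xi> = \<pi> a (\<pi> b \<xi>)) \<and>
    (\<forall>a. \<forall>\<xi>\<in>ell2. \<forall>\<eta>\<in>ell2. ell2_inner (\<pi> (star a) \<xi>) \<eta> = ell2_inner \<xi> (\<pi> a \<eta>))"

definition unitary_operator :: "(('i \<Rightarrow> complex) \<Rightarrow> ('i \<Rightarrow> complex)) \<Rightarrow> bool" where
  "unitary_operator U \<longleftrightarrow> bounded_operator U \<and> bij_betw U ell2 ell2 \<and>
    (\<forall>\<xi>\<in>ell2. \<forall>\<eta>\<in>ell2. ell2_inner (U \<xi>) (U \<eta>) = ell2_inner \<xi> \<eta>)"

text \<open>A unitary representation of the cyclic group of order \<open>n\<close> is given by the image \<open>U\<close> of the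
  generator, so it is enough to impose the covariance relation on \<open>U\<close>.\<close>

definition covariant_representation :: "nat \<Rightarrow> ('a::cstar_algebra \<Rightarrow> 'a) \<Rightarrow>
    ('a \<Rightarrow> ('i \<Rightarrow> complex) \<Rightarrow> ('i \<Rightarrow> complex)) \<Rightarrow> (('i \<Rightarrow> complex) \<Rightarrow> ('i \<Rightarrow> complex)) \<Rightarrow> bool" where
  "covariant_representation n \<alpha> \<pi> U \<longleftrightarrow>
    star_representation \<pi> \<and> unitary_operator U \<and>
    (\<forall>\<xi>\<in>ell2. (U ^^ n) \<xi> = \<xi>) \<and>
    (\<forall>a. \<forall>\<xi>\<in>ell2. U (\<pi> a \<xi>) = \<pi> (\<alpha> a) (U \<xi>))"

definition integrated_form :: "nat \<Rightarrow> ('a::cstar_algebra \<Rightarrow> ('i \<Rightarrow> complex) \<Rightarrow> ('i \<Rightarrow> complex)) \<Rightarrow>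
    (('i \<Rightarrow> complex) \<Rightarrow> ('i \<Rightarrow> complex)) \<Rightarrow> (nat \<Rightarrow> 'a) \<Rightarrow> ('i \<Rightarrow> complex) \<Rightarrow> ('i \<Rightarrow> complex)" where
  "integrated_form n \<pi> U f \<xi> = (\<lambda>i. \<Sum>k<n. \<pi> (f k) ((U ^^ k) \<xi>) i)"


section \<open>The crossed product by a cyclic group\<close>

text \<open>
  The cyclic group of order \<open>n > 0\<close> is \<open>{..<n}\<close> with addition modulo \<open>n\<close>, acting by \<open>k \<mapsto> \<alpha> ^^ k\<close>.
  Functions from the group to the algebra are extended by \<open>0\<close>. Their product is the twisted
  convolution \<open>(f g)(k) = (\<Sum>i. f(i) \<alpha>\<^sub>i(g(k - i)))\<close>, and \<open>f\<^sup>*(k) = \<alpha>\<^sub>k(f(-k)\<^sup>*)\<close>.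
\<close>

definition group_functions :: "nat \<Rightarrow> (nat \<Rightarrow> 'a::cstar_algebra) set" where
  "group_functions n = {f. \<forall>k\<ge>n. f k = 0}"

definition twisted_mult ::
    "nat \<Rightarrow> ('a::cstar_algebra \<Rightarrow> 'a) \<Rightarrow> (nat \<Rightarrow> 'a) \<Rightarrow> (nat \<Rightarrow> 'a) \<Rightarrow> (nat \<Rightarrow> 'a)" where
  "twisted_mult n \<alpha> f g =
    (\<lambda>k. if k < n then \<Sum>i<n. f i * (\<alpha> ^^ i) (g ((k + n - i) mod n)) else 0)"

definition twisted_star ::
    "nat \<Rightarrow> ('a::cstar_algebra \<Rightarrow> 'a) \<Rightarrow> (nat \<Rightarrow> 'a) \<Rightarrow> (nat \<Rightarrow> 'a)" where
  "twisted_star n \<alpha> f = (\<lambda>k. if k < n then (\<alpha> ^^ k) (star (f ((n - k) mod n))) else 0)"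

text \<open>
  The supremum over all covariant representations equals that over the cyclic ones. A cyclic
  representation space has a dense subset of cardinality at most that of \<open>{..<n} \<rightarrow> 'a\<close>, which is
  that of \<open>'a\<close> if the algebra is nonzero. It therefore embeds into \<open>\<ell>\<^sup>2\<close> over the index set \<open>'a\<close>
  (extend \<open>\<pi>\<close> by \<open>0\<close> and \<open>U\<close> by the identity), so this space is large enough to compute the norm.
  The set below is nonempty (\<open>\<pi> = 0\<close>) and bounded above by the 1-norm of \<open>f\<close>.
\<close>

definition universal_norm :: "nat \<Rightarrow> ('a::cstar_algebra \<Rightarrow> 'a) \<Rightarrow> (nat \<Rightarrow> 'a) \<Rightarrow> real" where
  "universal_norm n \<alpha> f = Sup {operator_norm (integrated_form n \<pi> U f) |
    (\<pi> :: 'a \<Rightarrow> ('a \<Rightarrow> complex) \<Rightarrow> ('a \<Rightarrow> complex)) U. covariant_representation n \<alpha> \<pi> U}"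

text \<open>
  The crossed product is the completion of the twisted convolution algebra in the universal norm.
  It is specified up to isometric *-isomorphism: a C*-algebra \<open>'b\<close> is the crossed product via \<open>\<iota>\<close>
  if \<open>\<iota>\<close> is a *-homomorphism that is isometric for the universal norm and has dense range. The
  completion has a unit, namely the image of the unit mass at the neutral element, so nothing
  is lost by taking \<open>'b\<close> unital.
\<close>

definition is_crossed_product ::
    "nat \<Rightarrow> ('a::cstar_algebra \<Rightarrow> 'a) \<Rightarrow> ((nat \<Rightarrow> 'a) \<Rightarrow> 'b::cstar_algebra) \<Rightarrow> bool" where
  "is_crossed_product n \<alpha> \<iota> \<longleftrightarrow>
    (\<forall>f\<in>group_functions n. \<forall>g\<in>group_functions n. \<iota> (\<lambda>k. f k + g k) = \<iota> f + \<iota> g) \<and>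
    (\<forall>c. \<forall>f\<in>group_functions n. \<iota> (\<lambda>k. c *\<^sub>C f k) = c *\<^sub>C \<iota> f) \<and>
    (\<forall>f\<in>group_functions n. \<forall>g\<in>group_functions n. \<iota> (twisted_mult n \<alpha> f g) = \<iota> f * \<iota> g) \<and>
    (\<forall>f\<in>group_functions n. \<iota> (twisted_star n \<alpha> f) = star (\<iota> f)) \<and>
    (\<forall>f\<in>group_functions n. norm (\<iota> f) = universal_norm n \<alpha> f) \<and>
    closure (\<iota> ` group_functions n) = UNIV"

end

theory Submission
  imports Defs "HOL-Computational_Algebra.Fundamental_Theorem_Algebra"
begin

text \<open>
  Write \<open>i\<close> for the canonical map of the algebra \<open>A\<close> into its crossed product and \<open>u\<close> for the
  unitary that implements the automorphism. If \<open>e\<^sub>0, ..., e\<^sub>n\<^sub>-\<^sub>1\<close> are Rokhlin projections, then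
  \<open>u\<^sup>j e\<^sub>0\<close> is approximately a partial isometry from \<open>e\<^sub>0\<close> onto \<open>e\<^sub>j\<close>. Every element \<open>a\<close> of the
  given finite set is approximately the sum of its corners \<open>e\<^sub>j a e\<^sub>j\<close>, which are approximately the
  conjugates by \<open>u\<^sup>j\<close> of elements of \<open>e\<^sub>0 A e\<^sub>0\<close>, and \<open>u\<close> approximately permutes the \<open>e\<^sub>j\<close>
  cyclically. So the crossed product is locally approximated by \<open>n \<times> n\<close> matrices over a corner
  of the AF algebra, and therefore by finite-dimensional *-subalgebras: if \<open>p\<close> is a projection
  close to \<open>e\<^sub>0\<close> in one of the finite-dimensional algebras \<open>B\<close> whose union is dense, and \<open>v\<^sub>j\<close> is
  the partial isometry in the polar decomposition of \<open>e\<^sub>j u\<^sup>j p\<close>, then the elements \<open>v\<^sub>j b v\<^sub>k\<^sup>*\<close>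
  with \<open>b\<close> in \<open>B\<close> span such a subalgebra. The product rule uses only \<open>v\<^sub>j\<^sup>* v\<^sub>k = \<delta>\<^sub>j\<^sub>k p\<close>, which
  holds exactly. This is \<open>AF_algebra_of_covariant_pair\<close>.

  It remains to pass from local approximation to an increasing sequence, which is Bratteli's
  theorem, \<open>AF_algebra_if_asymptotically_exhausted\<close>. The point is a perturbation result,
  \<open>asymptotic_unitary_conjugation\<close>: a finite-dimensional *-subalgebra whose elements are limits of
  elements of subalgebras \<open>E m\<close> is conjugated into \<open>E m\<close> by unitaries tending to 1. Its proof moves
  matrix units, which are constructed in \<open>findim_matrix_units\<close>.

  All approximate relations are made exact by one device, the binomial series for
  \<open>(1 - z)\<^sup>-\<^sup>1\<^sup>/\<^sup>2\<close>: it gives the partial isometry in a polar decomposition near a projection, the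
  projection near an almost idempotent element, and the contractivity of *-homomorphisms. As
  asymptotic statements are simpler to combine than estimates, the approximations are
  organised as sequences whose errors tend to zero.
\<close>

section \<open>Elementary facts about C*-algebras\<close>

lemma star_zero [simp]: "star (0::'a::cstar_algebra) = 0"
  by (metis add_cancel_right_left star_add)

lemma star_minus [simp]: "star (- a) = - star (a::'a::cstar_algebra)"
  by (metis add.right_inverse add_eq_0_iff star_add star_zero)

lemma star_diff: "star (a - b) = star a - star (b::'a::cstar_algebra)"
  by (metis add_uminus_conv_diff star_add star_minus)

lemma star_one [simp]: "star (1::'a::cstar_algebra) = 1"
  by (metis mult_1_left mult.right_neutral star_mult star_star)

lemma star_scaleR: "star (r *\<^sub>R a) = r *\<^sub>R star (a::'a::cstar_algebra)"
  by (metis complex_cnj_complex_of_real scaleC_of_real star_scaleC)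

lemma star_sum: "star (sum f A) = (\<Sum>i\<in>A. star (f i :: 'a::cstar_algebra))"
  by (induction A rule: infinite_finite_induct) (auto simp: star_add)

lemma star_power: "star (a ^ k) = star (a::'a::cstar_algebra) ^ k"
  by (induction k) (auto simp: star_mult power_commutes)

lemma norm_star [simp]: "norm (star a) = norm (a::'a::cstar_algebra)"
proof -
  have le: "norm b \<le> norm (star b)" for b :: 'a
  proof -
    have "norm b * norm b \<le> norm (star b) * norm b"
      using cstar_identity[of b] norm_mult_ineq[of "star b" b] by (simp add: power2_eq_square)
    then show ?thesis
      using mult_right_le_imp_le[of "norm b" "norm b"] by (cases "norm b = 0") auto
  qed
  show ?thesis using le[of a] le[of "star a"] by (simp add: star_star)
qed

lemma star_mult_eq_0_iff: "star a * a = 0 \<longleftrightarrow> a = (0::'a::cstar_algebra)"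
  using cstar_identity[of a] by auto

lemma bounded_linear_star: "bounded_linear (star :: 'a::cstar_algebra \<Rightarrow> 'a)"
  by (rule bounded_linear_intro[where K=1]) (auto simp: star_add star_scaleR)

lemmas tendsto_star [tendsto_intros] = bounded_linear.tendsto[OF bounded_linear_star]

lemma scaleC_minus_left: "(- c) *\<^sub>C a = - (c *\<^sub>C (a::'a::cstar_algebra))"
  by (simp add: complex_space.scale_minus_left)

lemma bounded_linear_scaleC: "bounded_linear (\<lambda>a::'a::cstar_algebra. c *\<^sub>C a)"
proof (rule bounded_linear_intro[where K="cmod c"])
  show "c *\<^sub>C (r *\<^sub>R x) = r *\<^sub>R (c *\<^sub>C x)" for r and x :: 'a
    by (simp add: scaleC_of_real[symmetric] scaleC_scaleC mult.commute)
qed (auto simp: scaleC_add_right norm_scaleC mult.commute)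

lemma norm_projection_le_1: "projection p \<Longrightarrow> norm (p::'a::cstar_algebra) \<le> 1"
  using cstar_identity[of p]
  by (auto simp: projection_def power2_eq_square)

lemma projection_norm_less_1:
  assumes "projection (p::'a::cstar_algebra)" "norm p < 1"
  shows "p = 0"
  using assms cstar_identity[of p] by (auto simp: projection_def power2_eq_square)

lemma projection_complement: "projection p \<Longrightarrow> projection (1 - p :: 'a::cstar_algebra)"
  by (auto simp: projection_def star_diff algebra_simps)

lemma projection_star_mult:
  assumes "projection p" "star v * v = (p :: 'a::cstar_algebra)"
  shows "v * p = v" "p * star v = star v" "projection (v * star v)"
proof -
  have "star (v - v * p) * (v - v * p) = 0"
    using assms by (simp add: projection_def star_diff star_mult algebra_simps)
       (metis mult.assoc)
  then show vp: "v * p = v" by (simp add: star_mult_eq_0_iff)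
  then show "p * star v = star v" using assms by (metis projection_def star_mult)
  show "projection (v * star v)"
    unfolding projection_def using vp assms by (metis mult.assoc star_mult star_star)
qed

lemma csubspace_imp_subspace: "csubspace V \<Longrightarrow> subspace (V :: 'a::cstar_algebra set)"
  unfolding complex_space.subspace_def subspace_def using scaleC_of_real by metis

text \<open>Coefficients with respect to a vector at positive distance from a closed subspace are
  controlled by the norm, so closedness survives adjoining one vector.\<close>

lemma closed_cspan_insert:
  fixes a :: "'a::cstar_algebra"
  assumes cl: "closed (cspan T)"
  shows "closed (cspan (insert a T))"
proof (cases "a \<in> cspan T")
  case True
  then show ?thesis using cl complex_space.span_redundant by metis
next
  case False
  define d where "d = infdist a (cspan T)"
  have ne: "cspan T \<noteq> {}" using complex_space.span_zero by blast
  have d: "d > 0"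
    using False cl ne in_closed_iff_infdist_zero[of "cspan T" a] infdist_nonneg[of a "cspan T"]
    unfolding d_def by force
  have lower: "cmod c * d \<le> norm (c *\<^sub>C a + t)" if "t \<in> cspan T" for c t
  proof (cases "c = 0")
    case False
    have "- (inverse c *\<^sub>C t) \<in> cspan T"
      using that by (simp add: complex_space.span_neg complex_space.span_scale)
    then have "d \<le> dist a (- (inverse c *\<^sub>C t))"
      unfolding d_def by (rule infdist_le)
    then have "cmod c * d \<le> cmod c * norm (a + inverse c *\<^sub>C t)"
      by (simp add: dist_norm mult_left_mono)
    also have "\<dots> = norm (c *\<^sub>C a + t)"
      using False by (simp add: norm_scaleC[symmetric] scaleC_add_right scaleC_scaleC)
    finally show ?thesis .
  qed simp
  show ?thesis
    unfolding closed_sequential_limits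
  proof (intro allI impI, elim conjE)
    fix x l assume x: "\<forall>n. x n \<in> cspan (insert a T)" and l: "x \<longlonglongrightarrow> l"
    have "\<forall>n. \<exists>c. x n - c *\<^sub>C a \<in> cspan T"
      using x complex_space.span_breakdown_eq by blast
    then obtain c where c: "\<And>n. x n - c n *\<^sub>C a \<in> cspan T" by metis
    have "Cauchy c"
    proof (rule metric_CauchyI)
      fix e :: real assume "e > 0"
      then obtain M where M: "\<And>m n. m \<ge> M \<Longrightarrow> n \<ge> M \<Longrightarrow> dist (x m) (x n) < e * d"
        using metric_CauchyD[OF LIMSEQ_imp_Cauchy[OF l]] d by (metis mult_pos_pos)
      have "dist (c m) (c n) < e" if "m \<ge> M" "n \<ge> M" for m n
      proof -
        have "(x m - c m *\<^sub>C a) - (x n - c n *\<^sub>C a) \<in> cspan T"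
          by (rule complex_space.span_diff[OF c c])
        from lower[OF this, of "c m - c n"]
        have "cmod (c m - c n) * d \<le> norm (x m - x n)"
          by (simp add: complex_space.scale_left_diff_distrib algebra_simps)
        also have "\<dots> < e * d" using M[OF that] by (simp add: dist_norm)
        finally show ?thesis using d by (simp add: dist_norm)
      qed
      then show "\<exists>M. \<forall>m\<ge>M. \<forall>n\<ge>M. dist (c m) (c n) < e" by blast
    qed
    then obtain c0 where c0: "c \<longlonglongrightarrow> c0" using Cauchy_convergent convergent_def by blast
    have "(\<lambda>n. (c n - c0) *\<^sub>C a) \<longlonglongrightarrow> 0"
      by (rule tendsto_norm_zero_cancel)
        (use c0 in \<open>auto simp: norm_scaleC intro!: tendsto_mult_left_zero tendsto_norm_zero LIM_zero\<close>)
    then have "(\<lambda>n. x n - c n *\<^sub>C a) \<longlonglongrightarrow> l - c0 *\<^sub>C a"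
      using tendsto_diff[OF tendsto_diff[OF l tendsto_const[of "c0 *\<^sub>C a"]]]
      by (fastforce simp: complex_space.scale_left_diff_distrib)
    then have "l - c0 *\<^sub>C a \<in> cspan T"
      using closed_sequentially[OF cl, of "\<lambda>n. x n - c n *\<^sub>C a"] c by blast
    then show "l \<in> cspan (insert a T)"
      using complex_space.span_breakdown_eq by blast
  qed
qed

lemma closed_cspan_finite: "finite S \<Longrightarrow> closed (cspan (S :: 'a::cstar_algebra set))"
proof (induction S rule: finite_induct)
  case empty
  then show ?case by (simp add: complex_space.span_empty)
next
  case (insert a T)
  then show ?case by (simp add: closed_cspan_insert)
qed

lemma closed_findim: "findim_star_subalgebra B \<Longrightarrow> closed B"
  unfolding findim_star_subalgebra_def using closed_cspan_finite by blast


section \<open>The inverse square root\<close>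

definition isqrt_coeff :: "nat \<Rightarrow> real" where
  "isqrt_coeff k = pochhammer (1/2) k / fact k"

text \<open>The binomial series of \<open>(1 - z)\<^sup>-\<^sup>1\<^sup>/\<^sup>2\<close>, which converges for \<open>norm z < 1\<close>.\<close>

definition inv_sqrt :: "'a::cstar_algebra \<Rightarrow> 'a" where
  "inv_sqrt z = (\<Sum>k. isqrt_coeff k *\<^sub>R z ^ k)"

lemma isqrt_coeff_0 [simp]: "isqrt_coeff 0 = 1"
  by (simp add: isqrt_coeff_def)

lemma isqrt_coeff_nonneg: "0 \<le> isqrt_coeff k"
  by (simp add: isqrt_coeff_def pochhammer_nonneg)

text \<open>The binomial theorem for rising factorials; it says that the square of the series below is
  the geometric series.\<close>

lemma isqrt_coeff_convolution: "(\<Sum>i\<le>k. isqrt_coeff i * isqrt_coeff (k - i)) = 1"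
proof -
  have "fact k = (\<Sum>i\<le>k. of_nat (k choose i) * pochhammer (1/2) i * pochhammer (1/2) (k - i) :: real)"
    using pochhammer_binomial_sum[of "1/2::real" "1/2" k] by (simp add: pochhammer_fact)
  also have "\<dots> = (\<Sum>i\<le>k. fact k * (isqrt_coeff i * isqrt_coeff (k - i)))"
    by (intro sum.cong) (auto simp: isqrt_coeff_def binomial_fact)
  finally show ?thesis by (simp add: sum_distrib_left[symmetric])
qed

lemma isqrt_coeff_le_1: "isqrt_coeff k \<le> 1"
proof -
  have "isqrt_coeff 0 * isqrt_coeff (k - 0) \<le> (\<Sum>i\<le>k. isqrt_coeff i * isqrt_coeff (k - i))"
    by (rule member_le_sum) (auto simp: isqrt_coeff_nonneg)
  then show ?thesis by (simp add: isqrt_coeff_convolution)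
qed

lemma norm_power_Suc_le: "norm (z ^ Suc k) \<le> norm (z::'a::cstar_algebra) ^ Suc k"
proof (induction k)
  case (Suc k)
  then show ?case
    using norm_mult_ineq[of z "z ^ Suc k"] mult_left_mono[OF Suc, of "norm z"] by simp
qed simp

lemma summable_norm_power: "norm (z::'a::cstar_algebra) < 1 \<Longrightarrow> summable (\<lambda>k. norm (z ^ k))"
  by (subst summable_Suc_iff[symmetric], rule summable_comparison_test'[of "\<lambda>k. norm z ^ Suc k" 0])
     (use norm_power_Suc_le summable_Suc_iff[of "\<lambda>k. norm z ^ k"] in
        \<open>auto simp del: power_Suc intro: summable_geometric\<close>)

context
  fixes z :: "'a::cstar_algebra"
  assumes z: "norm z < 1"
begin

lemma summable_isqrt_norm: "summable (\<lambda>k. norm (isqrt_coeff k *\<^sub>R z ^ k))"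
  by (rule summable_comparison_test'[OF summable_norm_power[OF z], of 0])
     (auto simp: isqrt_coeff_nonneg isqrt_coeff_le_1 mult_left_le_one_le)

lemma inv_sqrt_sums: "(\<lambda>k. isqrt_coeff k *\<^sub>R z ^ k) sums inv_sqrt z"
  unfolding inv_sqrt_def by (rule summable_sums[OF summable_norm_cancel[OF summable_isqrt_norm]])

lemma inv_sqrt_minus_1_sums: "(\<lambda>k. isqrt_coeff (Suc k) *\<^sub>R z ^ Suc k) sums (inv_sqrt z - 1)"
  using inv_sqrt_sums by (subst sums_Suc_iff) simp

text \<open>Membership in subalgebras, commutation, annihilation and symmetry of the inverse square root are
  all instances of this closedness statement, for different subspaces \<open>V\<close>.\<close>

lemma inv_sqrt_minus_1_mem:
  assumes "closed V" "subspace V" "\<And>k. z ^ Suc k \<in> V"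
  shows "inv_sqrt z - 1 \<in> V"
proof -
  have "(\<Sum>k<N. isqrt_coeff (Suc k) *\<^sub>R z ^ Suc k) \<in> V" for N
    using assms by (intro subspace_sum subspace_scale) auto
  then show ?thesis
    using inv_sqrt_minus_1_sums assms(1) unfolding sums_def
    by (rule_tac closed_sequentially) auto
qed

lemma inv_sqrt_commute:
  assumes "z * w = w * z"
  shows "inv_sqrt z * w = w * inv_sqrt z"
proof -
  have "inv_sqrt z - 1 \<in> {x. x * w = w * x}"
  proof (rule inv_sqrt_minus_1_mem)
    show "closed {x. x * w = w * x}"
      by (intro closed_Collect_eq continuous_intros)
    show "subspace {x. x * w = w * x}"
      by (auto simp: subspace_def algebra_simps)
    show "z ^ Suc k \<in> {x. x * w = w * x}" for k
    proof -
      have "z ^ j * w = w * z ^ j" for j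
      proof (induction j)
        case (Suc j)
        have "z ^ Suc j * w = z * (z ^ j * w)" by (simp add: mult.assoc)
        also have "\<dots> = w * z ^ Suc j" using Suc assms by (simp add: mult.assoc[symmetric])
        finally show ?case .
      qed simp
      then show ?thesis by blast
    qed
  qed
  then show ?thesis by (simp add: algebra_simps)
qed

lemma star_inv_sqrt:
  assumes "star z = z"
  shows "star (inv_sqrt z) = inv_sqrt z"
proof -
  have "inv_sqrt z - 1 \<in> {x. star x = x}"
  proof (rule inv_sqrt_minus_1_mem)
    show "closed {x::'a. star x = x}"
      by (intro closed_Collect_eq continuous_intros linear_continuous_on bounded_linear_star)
  qed (use assms in \<open>auto simp: subspace_def star_add star_scaleR star_power simp del: power_Suc\<close>)
  then show ?thesis by (simp add: star_diff)
qed

lemma inv_sqrt_square: "inv_sqrt z * inv_sqrt z * (1 - z) = 1"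
proof -
  have "(\<lambda>k. \<Sum>i\<le>k. (isqrt_coeff i *\<^sub>R z ^ i) * (isqrt_coeff (k - i) *\<^sub>R z ^ (k - i)))
      sums (inv_sqrt z * inv_sqrt z)"
    unfolding inv_sqrt_def by (rule Cauchy_product_sums) (rule summable_isqrt_norm)+
  moreover have "(\<Sum>i\<le>k. (isqrt_coeff i *\<^sub>R z ^ i) * (isqrt_coeff (k - i) *\<^sub>R z ^ (k - i))) = z ^ k" for k
  proof -
    have "(\<Sum>i\<le>k. (isqrt_coeff i *\<^sub>R z ^ i) * (isqrt_coeff (k - i) *\<^sub>R z ^ (k - i)))
        = (\<Sum>i\<le>k. (isqrt_coeff i * isqrt_coeff (k - i)) *\<^sub>R z ^ k)"
      by (intro sum.cong) (auto simp: power_add[symmetric])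
    then show ?thesis by (simp add: scaleR_sum_left[symmetric] isqrt_coeff_convolution)
  qed
  ultimately have s: "(\<lambda>k. z ^ k) sums (inv_sqrt z * inv_sqrt z)" by simp
  have "(\<lambda>k. z ^ k * (1 - z)) sums (inv_sqrt z * inv_sqrt z * (1 - z))"
    by (rule sums_mult2[OF s])
  moreover have "(\<lambda>k. z ^ k * (1 - z)) sums 1"
  proof -
    have "(\<Sum>k<N. z ^ k * (1 - z)) = 1 - z ^ N" for N
      by (induction N) (auto simp: algebra_simps power_commutes)
    moreover have "(\<lambda>N. 1 - z ^ N) \<longlonglongrightarrow> 1 - 0"
      by (intro tendsto_intros summable_LIMSEQ_zero sums_summable[OF s])
    ultimately show ?thesis by (simp add: sums_def)
  qed
  ultimately show ?thesis by (rule sums_unique2)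
qed

lemma norm_inv_sqrt_minus_1: "norm (inv_sqrt z - 1) \<le> norm z / (1 - norm z)"
proof -
  have g: "(\<lambda>k. norm z ^ Suc k) sums (norm z / (1 - norm z))"
    using sums_mult[OF geometric_sums[of "norm z"], of "norm z"] z by simp
  have "inv_sqrt z - 1 = (\<Sum>k. isqrt_coeff (Suc k) *\<^sub>R z ^ Suc k)"
    using inv_sqrt_minus_1_sums by (rule sums_unique)
  also have "norm \<dots> \<le> (\<Sum>k. norm z ^ Suc k)"
  proof (rule norm_suminf_le)
    show "norm (isqrt_coeff (Suc k) *\<^sub>R z ^ Suc k) \<le> norm z ^ Suc k" for k
      using norm_power_Suc_le[of z k] isqrt_coeff_nonneg[of "Suc k"] isqrt_coeff_le_1[of "Suc k"]
      by (simp del: power_Suc) (meson mult_left_le_one_le norm_ge_zero order_trans)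
  qed (rule sums_summable[OF g])
  finally show ?thesis using sums_unique[OF g] by simp
qed

end


definition star_homomorphism :: "('a::cstar_algebra \<Rightarrow> 'b::cstar_algebra) \<Rightarrow> bool" where
  "star_homomorphism f \<longleftrightarrow>
    (\<forall>a b. f (a + b) = f a + f b) \<and> (\<forall>c a. f (c *\<^sub>C a) = c *\<^sub>C f a) \<and>
    (\<forall>a b. f (a * b) = f a * f b) \<and> (\<forall>a. f (star a) = star (f a))"

lemma star_homomorphism_scaleR:
  "star_homomorphism f \<Longrightarrow> f (r *\<^sub>R a) = r *\<^sub>R f a"
  unfolding star_homomorphism_def by (metis scaleC_of_real)

lemma star_homomorphism_diff:
  "star_homomorphism f \<Longrightarrow> f (a - b) = f a - f b"
  unfolding star_homomorphism_def by (metis add_diff_cancel_right' diff_add_cancel)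

text \<open>If \<open>h\<close> is a self-adjoint strict contraction then \<open>s = (1 - h\<^sup>2)\<^sup>1\<^sup>/\<^sup>2\<close> is self-adjoint and commutes
  with \<open>h\<close>, so \<open>h + i s\<close> is unitary. For its image \<open>w\<close> under a *-homomorphism \<open>w\<^sup>* w\<close> is the
  projection that is the image of 1. Hence \<open>w\<close> is a contraction, and so is its real part, the
  image of \<open>h\<close>.\<close>

lemma star_homomorphism_contractive:
  fixes f :: "'a::cstar_algebra \<Rightarrow> 'b::cstar_algebra"
  assumes f: "star_homomorphism f"
  shows "norm (f a) \<le> norm a"
proof -
  have unit: "norm (f h) \<le> 1" if h: "star h = h" "norm h < 1" for h
  proof -
    define s where "s = (1 - h * h) * inv_sqrt (h * h)"
    have z: "norm (h * h) < 1"
      using h cstar_identity[of h] by (simp add: power2_eq_square) (metis mult_strict_mono norm_ge_zero mult_1 zero_less_one)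
    have c1: "inv_sqrt (h * h) * h = h * inv_sqrt (h * h)"
      by (rule inv_sqrt_commute[OF z]) (simp add: mult.assoc)
    then have c2: "inv_sqrt (h * h) * (1 - h * h) = (1 - h * h) * inv_sqrt (h * h)"
      by (simp add: right_diff_distrib left_diff_distrib mult.assoc[symmetric]) (simp add: mult.assoc)
    have st: "star (inv_sqrt (h * h)) = inv_sqrt (h * h)"
      by (rule star_inv_sqrt[OF z]) (simp add: star_mult h)
    have s1: "star s = s"
      by (simp add: s_def star_mult st star_diff h c2)
    have s2: "h * s = s * h"
    proof -
      have "s * h = (1 - h * h) * (h * inv_sqrt (h * h))" by (simp add: s_def mult.assoc c1)
      then show ?thesis by (simp add: s_def algebra_simps)
    qed
    have "s * s = (1 - h * h) * (inv_sqrt (h * h) * (1 - h * h) * inv_sqrt (h * h))"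
      by (simp add: s_def mult.assoc)
    also have "inv_sqrt (h * h) * (1 - h * h) * inv_sqrt (h * h)
        = inv_sqrt (h * h) * inv_sqrt (h * h) * (1 - h * h)"
      by (metis c2 mult.assoc)
    finally have s3: "s * s = 1 - h * h" using inv_sqrt_square[OF z] by simp
    define w where "w = f h + \<i> *\<^sub>C f s"
    have f1: "projection (f 1)"
      using f unfolding projection_def star_homomorphism_def by (metis mult_1 star_one)
    have sw: "star w = f h - \<i> *\<^sub>C f s"
      using f h s1 unfolding w_def star_homomorphism_def
      by (metis add_uminus_conv_diff complex_cnj_i scaleC_minus_left star_add star_scaleC)
    have "star w * w = f h * f h + f s * f s + \<i> *\<^sub>C (f h * f s - f s * f h)"
      unfolding sw unfolding w_def
      by (simp add: algebra_simps mult_scaleC_left mult_scaleC_right scaleC_scaleC scaleC_minus_left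
          complex_space.scale_right_diff_distrib)
    also have "\<dots> = f (h * h + s * s)"
      using f s2 unfolding star_homomorphism_def
      by (metis add.right_neutral cancel_comm_monoid_add_class.diff_cancel complex_space.scale_zero_right)
    finally have "star w * w = f 1" by (simp add: s3)
    then have "(norm w)\<^sup>2 \<le> 1" using cstar_identity[of w] norm_projection_le_1[OF f1] by simp
    then have "norm w \<le> 1" using power2_le_imp_le[of "norm w" 1] by simp
    moreover have "2 *\<^sub>R f h = w + star w" unfolding sw by (simp add: w_def scaleR_2)
    then have "2 * norm (f h) \<le> norm w + norm (star w)"
      by (metis norm_scaleR norm_triangle_ineq abs_numeral)
    ultimately show ?thesis by simp
  qed
  have sa: "norm (f h) \<le> norm h" if h: "star h = h" for h
  proof (rule field_le_epsilon)
    fix e :: real assume e: "e > 0"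
    let ?c = "norm h + e"
    have c: "?c > 0" using e norm_ge_zero[of h] by linarith
    have "norm (f (inverse ?c *\<^sub>R h)) \<le> 1"
      using h c e by (intro unit) (auto simp: star_scaleR field_simps abs_if)
    then have "inverse ?c * norm (f h) \<le> 1"
      using c by (simp add: star_homomorphism_scaleR[OF f] abs_if)
    then show "norm (f h) \<le> ?c"
      using c by (simp add: field_simps)
  qed
  have "(norm (f a))\<^sup>2 = norm (f (star a * a))"
    using f cstar_identity[of "f a"] unfolding star_homomorphism_def by metis
  also have "\<dots> \<le> norm (star a * a)" by (rule sa) (simp add: star_mult star_star)
  finally show ?thesis by (simp add: cstar_identity)
qed


section \<open>Exact projections and partial isometries from approximate ones\<close>

definition closed_star_subalgebra :: "'a::cstar_algebra set \<Rightarrow> bool" where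
  "closed_star_subalgebra E \<longleftrightarrow> closed E \<and> csubspace E \<and>
    (\<forall>a\<in>E. \<forall>b\<in>E. a * b \<in> E) \<and> (\<forall>a\<in>E. star a \<in> E)"

lemma findim_closed_star_subalgebra:
  "findim_star_subalgebra B \<Longrightarrow> closed_star_subalgebra B"
  using closed_findim unfolding closed_star_subalgebra_def findim_star_subalgebra_def by blast

lemma closed_star_subalgebraD:
  assumes "closed_star_subalgebra E"
  shows "0 \<in> E" "a \<in> E \<Longrightarrow> b \<in> E \<Longrightarrow> a + b \<in> E" "a \<in> E \<Longrightarrow> b \<in> E \<Longrightarrow> a - b \<in> E"
    "a \<in> E \<Longrightarrow> b \<in> E \<Longrightarrow> a * b \<in> E" "a \<in> E \<Longrightarrow> star a \<in> E" "a \<in> E \<Longrightarrow> r *\<^sub>R a \<in> E"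
    "a \<in> E \<Longrightarrow> c *\<^sub>C a \<in> E" "(\<And>i. i \<in> I \<Longrightarrow> g i \<in> E) \<Longrightarrow> sum g I \<in> E"
proof -
  have E: "csubspace E" using assms by (simp add: closed_star_subalgebra_def)
  note R = csubspace_imp_subspace[OF E]
  show "0 \<in> E" "a \<in> E \<Longrightarrow> b \<in> E \<Longrightarrow> a + b \<in> E" "a \<in> E \<Longrightarrow> b \<in> E \<Longrightarrow> a - b \<in> E"
    "a \<in> E \<Longrightarrow> r *\<^sub>R a \<in> E" "a \<in> E \<Longrightarrow> c *\<^sub>C a \<in> E" "(\<And>i. i \<in> I \<Longrightarrow> g i \<in> E) \<Longrightarrow> sum g I \<in> E"
    using E R by (auto simp: subspace_0 subspace_add subspace_diff subspace_scale
        complex_space.subspace_scale intro: subspace_sum)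
  show "a \<in> E \<Longrightarrow> b \<in> E \<Longrightarrow> a * b \<in> E" "a \<in> E \<Longrightarrow> star a \<in> E"
    using assms by (auto simp: closed_star_subalgebra_def)
qed

text \<open>For \<open>x p = x\<close> with \<open>x\<^sup>* x\<close> close to the projection \<open>p\<close>, this is the partial isometry
  \<open>x (x\<^sup>* x)\<^sup>-\<^sup>1\<^sup>/\<^sup>2\<close> of the polar decomposition, the inverse being taken in the corner of \<open>p\<close>.\<close>

definition polar_part :: "'a::cstar_algebra \<Rightarrow> 'a \<Rightarrow> 'a" where
  "polar_part p x = x * inv_sqrt (p - star x * x)"

lemma polar_part_isometry:
  assumes p: "projection p" and xp: "x * p = x" and z: "norm (p - star x * x) < 1"
  shows "star (polar_part p x) * polar_part p x = p"
proof -
  define z where "z = p - star x * x"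
  have z1: "norm z < 1" using assms by (simp add: z_def)
  have px: "p * star x = star x" using p xp by (metis projection_def star_mult)
  have pp: "p * p = p" "star p = p" using p by (auto simp: projection_def)
  have zp: "z * p = z" "p * z = z"
    using xp px pp by (simp_all add: z_def algebra_simps) (metis mult.assoc)
  have sz: "star z = z" using pp by (simp add: z_def star_diff star_mult star_star)
  have rp: "inv_sqrt z * p = p * inv_sqrt z" by (rule inv_sqrt_commute[OF z1]) (simp add: zp)
  have sx: "star x * x = (1 - z) * p" by (simp add: z_def algebra_simps zp pp) (metis xp mult.assoc)
  have cz: "inv_sqrt z * (1 - z) = (1 - z) * inv_sqrt z"
    by (rule inv_sqrt_commute[OF z1]) (simp add: algebra_simps)
  have "star (polar_part p x) * polar_part p x = inv_sqrt z * (star x * x) * inv_sqrt z"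
    unfolding polar_part_def z_def[symmetric] by (simp add: star_mult star_inv_sqrt[OF z1 sz] mult.assoc)
  also have "\<dots> = inv_sqrt z * (1 - z) * (p * inv_sqrt z)" unfolding sx by (simp add: mult.assoc)
  also have "\<dots> = (1 - z) * inv_sqrt z * (inv_sqrt z * p)" unfolding cz rp ..
  also have "\<dots> = inv_sqrt z * inv_sqrt z * (1 - z) * p" by (metis cz mult.assoc)
  finally show ?thesis by (simp add: inv_sqrt_square[OF z1])
qed

lemma polar_part_mem:
  assumes E: "closed_star_subalgebra E" and xE: "x \<in> E" and p: "projection p" and xp: "x * p = x"
    and z: "norm (p - star x * x) < 1"
  shows "polar_part p x \<in> E"
proof -
  define z where "z = p - star x * x"
  have pp: "p * p = p" "p * star x = star x" using p xp by (metis projection_def star_mult)+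
  have zp: "z * p = z"
    using xp pp by (simp add: z_def algebra_simps)
  \<comment> \<open>Every factor \<open>p\<close> in a power of \<open>z\<close> is absorbed from the left, which leaves products of
    \<open>x\<close> and its adjoint.\<close>
  have pow: "x * z ^ k \<in> E \<and> x * z ^ k * p = x * z ^ k" for k
  proof (induction k)
    case (Suc k)
    have "x * z ^ Suc k = x * z ^ k * p - x * z ^ k * (star x * x)"
      unfolding power_Suc2 z_def[symmetric] by (simp add: z_def right_diff_distrib mult.assoc)
    then have "x * z ^ Suc k \<in> E"
      using Suc xE by (auto intro!: closed_star_subalgebraD[OF E])
    moreover have "x * z ^ Suc k * p = x * z ^ Suc k"
      unfolding power_Suc2 by (simp add: mult.assoc zp)
    ultimately show ?case by blast
  qed (use xE xp in auto)
  have "inv_sqrt z - 1 \<in> {y. x * y \<in> E}"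
  proof (rule inv_sqrt_minus_1_mem)
    show "norm z < 1" using z by (simp add: z_def)
    show "closed {y. x * y \<in> E}"
      using E continuous_closed_vimage[of E "\<lambda>y. x * y"]
      by (simp add: closed_star_subalgebra_def vimage_def)
    show "subspace {y. x * y \<in> E}"
      using closed_star_subalgebraD[OF E] by (auto simp: subspace_def distrib_left)
  qed (use pow in blast)
  then have "x * (inv_sqrt z - 1) + x \<in> E" using xE by (auto intro: closed_star_subalgebraD[OF E])
  then show ?thesis unfolding polar_part_def z_def[symmetric] by (simp add: algebra_simps)
qed

lemma inv_sqrt_tendsto_1:
  fixes z :: "nat \<Rightarrow> 'a::cstar_algebra"
  assumes "z \<longlonglongrightarrow> 0"
  shows "(\<lambda>m. inv_sqrt (z m)) \<longlonglongrightarrow> 1"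
proof -
  have nz: "(\<lambda>m. norm (z m)) \<longlonglongrightarrow> 0" using assms by (rule tendsto_norm_zero)
  have "(\<lambda>m. norm (z m) / (1 - norm (z m))) \<longlonglongrightarrow> 0 / (1 - 0)"
    by (intro tendsto_intros nz) auto
  moreover have "\<forall>\<^sub>F m in sequentially. norm (z m) < 1"
    using order_tendstoD(2)[OF nz, of 1] by simp
  then have "\<forall>\<^sub>F m in sequentially. norm (inv_sqrt (z m) - 1) \<le> norm (z m) / (1 - norm (z m))"
    by eventually_elim (rule norm_inv_sqrt_minus_1)
  ultimately have "(\<lambda>m. inv_sqrt (z m) - 1) \<longlonglongrightarrow> 0"
    using Lim_null_comparison by fastforce
  then show ?thesis by (simp add: LIM_zero_iff)
qed

text \<open>For a self-adjoint \<open>b\<close> close to its square this is the spectral projection of \<open>b\<close> for the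
  interval \<open>[1/2, \<infinity>)\<close>: with \<open>s = 2 b - 1\<close> one has \<open>s\<^sup>2 = 1 - 4 (b - b\<^sup>2)\<close>, and the symmetry
  \<open>s (s\<^sup>2)\<^sup>-\<^sup>1\<^sup>/\<^sup>2\<close> is \<open>2 e - 1\<close> for a projection \<open>e\<close>.\<close>

definition nearby_projection :: "'a::cstar_algebra \<Rightarrow> 'a" where
  "nearby_projection b = (1/2) *\<^sub>R (1 + (2 *\<^sub>R b - 1) * inv_sqrt (4 *\<^sub>R (b - b * b)))"

lemma nearby_projection_alt:
  "nearby_projection b = b + (b - (1/2) *\<^sub>R 1) * (inv_sqrt (4 *\<^sub>R (b - b * b)) - 1)"
  by (simp add: nearby_projection_def algebra_simps scaleR_2) (simp flip: scaleR_add_left)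

lemma projection_nearby_projection:
  assumes b: "star b = b" and z: "norm (4 *\<^sub>R (b - b * b)) < 1"
  shows "projection (nearby_projection b)"
proof -
  define z where "z = 4 *\<^sub>R (b - b * b)"
  define s where "s = 2 *\<^sub>R b - 1"
  define t where "t = s * inv_sqrt z"
  have z1: "norm z < 1" using z by (simp add: z_def)
  have ss: "s * s = 1 - z" 
    by (simp add: s_def z_def algebra_simps) (simp flip: scaleR_add_left)
  have r: "inv_sqrt z * s = s * inv_sqrt z"
    by (rule inv_sqrt_commute[OF z1]) (simp add: s_def z_def algebra_simps)
  have "star z = z" "star s = s" by (simp_all add: z_def s_def star_scaleR star_diff star_mult b)
  then have st: "star t = t" using r by (simp add: t_def star_mult star_inv_sqrt[OF z1])
  have "t * t = (inv_sqrt z * s) * (s * inv_sqrt z)" by (simp add: t_def r)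
  also have "\<dots> = inv_sqrt z * (s * s * inv_sqrt z)" by (simp add: mult.assoc)
  also have "\<dots> = inv_sqrt z * (inv_sqrt z * (s * s))" by (metis r mult.assoc)
  finally have tt: "t * t = 1" using inv_sqrt_square[OF z1] by (simp add: ss mult.assoc)
  have "nearby_projection b = (1/2) *\<^sub>R (1 + t)"
    by (simp add: nearby_projection_def t_def s_def z_def)
  then show ?thesis
    by (simp add: projection_def star_scaleR star_add st algebra_simps tt)
      (simp flip: scaleR_add_left)
qed

lemma nearby_projection_mem:
  assumes E: "closed_star_subalgebra E" and b: "b \<in> E" and z: "norm (4 *\<^sub>R (b - b * b)) < 1"
  shows "nearby_projection b \<in> E"
proof -
  have zE: "4 *\<^sub>R (b - b * b) \<in> E" using b by (auto intro!: closed_star_subalgebraD[OF E])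
  have "inv_sqrt (4 *\<^sub>R (b - b * b)) - 1 \<in> E"
  proof (rule inv_sqrt_minus_1_mem[OF z])
    show "closed E" "subspace E"
      using E csubspace_imp_subspace by (auto simp: closed_star_subalgebra_def)
    show "(4 *\<^sub>R (b - b * b)) ^ Suc k \<in> E" for k
    proof (induction k)
      case (Suc k)
      then show ?case using closed_star_subalgebraD(4)[OF E zE Suc] by (subst power_Suc)
    qed (use zE in simp)
  qed
  then have "b + (b * (inv_sqrt (4 *\<^sub>R (b - b * b)) - 1) -
      (1/2) *\<^sub>R (inv_sqrt (4 *\<^sub>R (b - b * b)) - 1)) \<in> E"
    using b by (auto intro!: closed_star_subalgebraD[OF E])
  then show ?thesis unfolding nearby_projection_alt by (simp add: algebra_simps)
qed

lemma nearby_projection_annihilates: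
  assumes qb: "q * b = 0" and z: "norm (4 *\<^sub>R (b - b * b)) < 1"
  shows "q * nearby_projection b = 0"
proof -
  have "inv_sqrt (4 *\<^sub>R (b - b * b)) - 1 \<in> {y. q * y = 0}"
  proof (rule inv_sqrt_minus_1_mem[OF z])
    show "closed {y. q * y = 0}" by (intro closed_Collect_eq continuous_intros)
    show "subspace {y. q * y = 0}" by (auto simp: subspace_def distrib_left)
    have "q * (b * c) = 0" for c using qb by (metis mult.assoc mult_zero_left)
    then show "(4 *\<^sub>R (b - b * b)) ^ Suc k \<in> {y. q * y = 0}" for k
      by (simp add: algebra_simps qb)
  qed
  moreover have "q * (b * c) = 0" for c using qb by (metis mult.assoc mult_zero_left)
  ultimately show ?thesis by (simp add: nearby_projection_alt distrib_left left_diff_distrib right_diff_distrib[of q] qb)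
qed

lemma nearby_projection_tendsto:
  assumes b: "b \<longlonglongrightarrow> p" and p: "projection p"
  shows "(\<lambda>m. nearby_projection (b m)) \<longlonglongrightarrow> p"
    and "\<forall>\<^sub>F m in sequentially. norm (4 *\<^sub>R (b m - b m * b m)) < 1"
proof -
  have "(\<lambda>m. 4 *\<^sub>R (b m - b m * b m)) \<longlonglongrightarrow> 4 *\<^sub>R (p - p * p)"
    by (intro tendsto_intros b)
  then have z: "(\<lambda>m. 4 *\<^sub>R (b m - b m * b m)) \<longlonglongrightarrow> 0" using p by (simp add: projection_def)
  have "(\<lambda>m. (1/2) *\<^sub>R (1 + (2 *\<^sub>R b m - 1) * inv_sqrt (4 *\<^sub>R (b m - b m * b m))))
      \<longlonglongrightarrow> (1/2) *\<^sub>R (1 + (2 *\<^sub>R p - 1) * 1)"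
    by (intro tendsto_intros b inv_sqrt_tendsto_1 z)
  then show "(\<lambda>m. nearby_projection (b m)) \<longlonglongrightarrow> p"
    by (simp add: nearby_projection_def)
  show "\<forall>\<^sub>F m in sequentially. norm (4 *\<^sub>R (b m - b m * b m)) < 1"
    using order_tendstoD(2)[OF tendsto_norm_zero[OF z], of 1] by simp
qed


section \<open>Matrix units in finite-dimensional *-algebras\<close>

lemma findim_dim_less:
  fixes H :: "'a::cstar_algebra set"
  assumes "finite S" "H \<subseteq> cspan S" and K: "csubspace K" "K \<subset> H"
  shows "complex_space.dim K < complex_space.dim H"
proof -
  obtain B where B: "B \<subseteq> K" "complex_space.independent B" "K \<subseteq> cspan B" "card B = complex_space.dim K"
    using complex_space.basis_exists by blast
  obtain C where C: "C \<subseteq> H" "complex_space.independent C" "H \<subseteq> cspan C" "card C = complex_space.dim H"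
    using complex_space.basis_exists by blast
  have fC: "finite C"
    using complex_space.independent_span_bound[OF assms(1) C(2)] C(1) assms(2) by blast
  obtain x where x: "x \<in> H" "x \<notin> K" using K by blast
  have "cspan B \<subseteq> K" using B(1) K(1) by (rule complex_space.span_minimal)
  then have xB: "x \<notin> cspan B" using x by blast
  have "complex_space.independent (insert x B)" using xB B(2) by (rule complex_space.independent_insertI)
  moreover have "x \<notin> B" using x(2) B(1) by blast
  moreover have "insert x B \<subseteq> cspan C" using x B K C by blast
  ultimately have "card (insert x B) \<le> card C" "finite (insert x B)"
    using complex_space.independent_span_bound[OF fC, of "insert x B"] by auto
  then show ?thesis using B(4) C(4) \<open>x \<notin> B\<close> by simp
qed

lemma nontrivial_linear_relation:
  fixes f :: "nat \<Rightarrow> 'a::cstar_algebra"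
  assumes S: "finite S" and f: "\<And>i. f i \<in> cspan S"
  shows "\<exists>N c. (\<exists>i\<le>N. c i \<noteq> 0) \<and> (\<Sum>i\<le>N. c i *\<^sub>C f i) = 0"
proof (cases "inj_on f {..card S}")
  case True
  have "card (f ` {..card S}) = Suc (card S)" using True by (simp add: card_image)
  then have "complex_space.dependent (f ` {..card S})"
    using complex_space.independent_span_bound[OF S, of "f ` {..card S}"] f by fastforce
  then obtain u where "\<exists>v\<in>f ` {..card S}. u v \<noteq> 0" "(\<Sum>v\<in>f ` {..card S}. u v *\<^sub>C v) = 0"
    by (subst (asm) complex_space.dependent_finite) auto
  then show ?thesis
    using True by (intro exI[of _ "card S"] exI[of _ "u \<circ> f"]) (auto simp: sum.reindex)
next
  case False
  then obtain i j where ij: "i \<noteq> j" "f i = f j" "i \<le> card S" "j \<le> card S"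
    by (auto simp: inj_on_def)
  define c :: "nat \<Rightarrow> complex" where "c = (\<lambda>k. if k = i then 1 else if k = j then -1 else 0)"
  have "(\<Sum>k\<le>card S. c k *\<^sub>C f k) = (\<Sum>k\<in>{i, j}. c k *\<^sub>C f k)"
    using ij by (intro sum.mono_neutral_right) (auto simp: c_def)
  also have "\<dots> = 0" using ij by (simp add: c_def scaleC_minus_left)
  finally show ?thesis using ij by (intro exI[of _ "card S"] exI[of _ c]) (auto simp: c_def)
qed

definition poly_apply :: "complex poly \<Rightarrow> 'a::cstar_algebra \<Rightarrow> 'a \<Rightarrow> 'a" where
  "poly_apply P h v = (\<Sum>i\<le>degree P. coeff P i *\<^sub>C (h ^ i * v))"

lemma poly_apply_upto:
  "degree P \<le> n \<Longrightarrow> poly_apply P h v = (\<Sum>i\<le>n. coeff P i *\<^sub>C (h ^ i * v))"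
  unfolding poly_apply_def by (intro sum.mono_neutral_left) (auto simp: coeff_eq_0)

lemma poly_apply_linear_factor:
  "poly_apply ([:- l, 1:] * Q) h v = poly_apply Q h (h * v - l *\<^sub>C v)"
proof -
  let ?n = "degree Q"
  have "degree ([:- l, 1:] * Q) \<le> Suc ?n" using degree_mult_le[of "[:- l, 1:]" Q] by simp
  then have "poly_apply ([:- l, 1:] * Q) h v
      = (\<Sum>i\<le>Suc ?n. coeff ([:- l, 1:] * Q) i *\<^sub>C (h ^ i * v))"
    by (rule poly_apply_upto)
  also have "\<dots> = (\<Sum>i\<le>Suc ?n. coeff (pCons 0 Q) i *\<^sub>C (h ^ i * v))
      - (\<Sum>i\<le>Suc ?n. (l * coeff Q i) *\<^sub>C (h ^ i * v))"
    unfolding sum_subtractf[symmetric]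
    by (intro sum.cong) (simp_all add: complex_space.scale_left_diff_distrib[symmetric] del: sum.atMost_Suc)
  also have "(\<Sum>i\<le>Suc ?n. coeff (pCons 0 Q) i *\<^sub>C (h ^ i * v))
      = (\<Sum>i\<le>?n. coeff Q i *\<^sub>C (h ^ i * (h * v)))"
    by (subst sum.atMost_Suc_shift) (simp add: power_commutes mult.assoc[symmetric])
  also have "(\<Sum>i\<le>Suc ?n. (l * coeff Q i) *\<^sub>C (h ^ i * v))
      = (\<Sum>i\<le>?n. coeff Q i *\<^sub>C (h ^ i * (l *\<^sub>C v)))"
    by (simp add: coeff_eq_0 mult_scaleC_right scaleC_scaleC mult.commute)
  finally show ?thesis
    by (simp add: poly_apply_def sum_subtractf[symmetric] right_diff_distrib
        complex_space.scale_right_diff_distrib)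
qed

text \<open>Splitting off a linear factor either exhibits \<open>v\<close> as an eigenvector or replaces it by the
  nonzero vector \<open>h v - l v\<close>, which is annihilated by a polynomial of smaller degree.\<close>

lemma eigenvector_of_poly_apply_eq_0:
  assumes V: "csubspace V" "\<And>x. x \<in> V \<Longrightarrow> h * x \<in> V"
    and "P \<noteq> 0" "v \<in> V" "v \<noteq> 0" "poly_apply P h v = 0"
  shows "\<exists>l x. x \<in> V \<and> x \<noteq> 0 \<and> h * x = l *\<^sub>C x"
  using assms(3-)
proof (induction "degree P" arbitrary: P v rule: less_induct)
  case less
  show ?case
  proof (cases "degree P = 0")
    case True
    then obtain c where "P = [:c:]" by (rule degree_eq_zeroE)
    then show ?thesis using less.prems by (simp add: poly_apply_def)
  next
    case False
    then obtain l where "poly P l = 0"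
      using fundamental_theorem_of_algebra[of P] by (auto simp: constant_degree)
    then obtain Q where Q: "P = [:- l, 1:] * Q" by (metis poly_eq_0_iff_dvd dvdE)
    show ?thesis
    proof (cases "h * v - l *\<^sub>C v = 0")
      case True
      then show ?thesis using less.prems by auto
    next
      case nz: False
      have "Q \<noteq> 0" using less.prems(1) Q by auto
      then have "degree Q < degree P" unfolding Q by (subst degree_mult_eq) auto
      moreover have "h * v - l *\<^sub>C v \<in> V"
        using V less.prems by (intro complex_space.subspace_diff complex_space.subspace_scale) auto
      ultimately show ?thesis
        using less.hyps[of Q "h * v - l *\<^sub>C v"] nz less.prems \<open>Q \<noteq> 0\<close> Q
        by (simp add: poly_apply_linear_factor del: mult_pCons_left)
    qed
  qed
qed

lemma exists_eigenvector:
  fixes h :: "'a::cstar_algebra"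
  assumes V: "csubspace V" "V \<subseteq> cspan S" "finite S" "\<And>x. x \<in> V \<Longrightarrow> h * x \<in> V"
    and v: "v \<in> V" "v \<noteq> 0"
  shows "\<exists>l x. x \<in> V \<and> x \<noteq> 0 \<and> h * x = l *\<^sub>C x"
proof -
  have "h ^ i * v \<in> V" for i
    by (induction i) (use V v in \<open>auto simp: mult.assoc\<close>)
  then obtain N c where c: "\<exists>i\<le>N. c i \<noteq> 0" "(\<Sum>i\<le>N. c i *\<^sub>C (h ^ i * v)) = 0"
    using nontrivial_linear_relation[OF V(3), of "\<lambda>i. h ^ i * v"] V(2) by blast
  define P where "P = (\<Sum>i\<le>N. monom (c i) i)"
  have co: "coeff P i = (if i \<le> N then c i else 0)" for i
    by (simp add: P_def coeff_sum)
  then have "degree P \<le> N" by (intro degree_le) auto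
  then have "poly_apply P h v = 0" using c by (simp add: poly_apply_upto co)
  moreover have "P \<noteq> 0" using c co by (metis coeff_0)
  ultimately show ?thesis using eigenvector_of_poly_apply_eq_0[OF V(1,4)] v by blast
qed

text \<open>The last condition makes all corners \<open>e D e\<close> for projections \<open>e\<close> in \<open>H\<close> lie in \<open>H\<close>, which is how
  minimality inside \<open>H\<close> becomes minimality inside \<open>D\<close>.\<close>

definition hereditary_subalgebra :: "'a::cstar_algebra set \<Rightarrow> 'a set \<Rightarrow> bool" where
  "hereditary_subalgebra D H \<longleftrightarrow> csubspace H \<and> H \<subseteq> D \<and> (\<forall>x\<in>H. star x \<in> H) \<and>
    (\<forall>x\<in>H. \<forall>y\<in>H. x * y \<in> H) \<and> (\<forall>x\<in>H. \<forall>d\<in>D. \<forall>y\<in>H. x * d * y \<in> H)"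

definition minimal_projection :: "'a::cstar_algebra set \<Rightarrow> 'a \<Rightarrow> bool" where
  "minimal_projection D e \<longleftrightarrow> e \<in> D \<and> projection e \<and> e \<noteq> 0 \<and> (\<forall>d\<in>D. \<exists>c. e * d * e = c *\<^sub>C e)"

text \<open>A nonzero hereditary subalgebra \<open>H\<close> that is minimal for inclusion satisfies \<open>b H b = H\<close> for
  every self-adjoint \<open>b \<noteq> 0\<close> in \<open>H\<close>, hence has no zero divisors. An eigenvector of left
  multiplication by \<open>h\<close> then shows that \<open>h\<close> acts on \<open>H\<close> from the right as a scalar, so that
  \<open>H\<close> is one-dimensional and spanned by a projection.\<close>

lemma hereditary_contains_minimal_projection:
  fixes D :: "'a::cstar_algebra set"
  assumes D: "findim_star_subalgebra D" and H0: "hereditary_subalgebra D H0" "H0 \<noteq> {0}"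
  shows "\<exists>e\<in>H0. minimal_projection D e"
proof -
  obtain S where S: "finite S" "D = cspan S" using D by (auto simp: findim_star_subalgebra_def)
  let ?C = "\<lambda>H. hereditary_subalgebra D H \<and> H \<subseteq> H0 \<and> H \<noteq> {0}"
  obtain H where H: "?C H" and least: "\<And>K. ?C K \<Longrightarrow> complex_space.dim H \<le> complex_space.dim K"
    using ex_has_least_nat[of ?C H0 complex_space.dim] H0 by blast
  have Hs: "csubspace H" "H \<subseteq> D" "\<And>x. x \<in> H \<Longrightarrow> star x \<in> H"
    "\<And>x y. x \<in> H \<Longrightarrow> y \<in> H \<Longrightarrow> x * y \<in> H" "\<And>x d y. x \<in> H \<Longrightarrow> d \<in> D \<Longrightarrow> y \<in> H \<Longrightarrow> x * d * y \<in> H"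
    using H by (auto simp: hereditary_subalgebra_def)
  have Dm: "x * y \<in> D" if "x \<in> D" "y \<in> D" for x y
    using D that by (auto simp: findim_star_subalgebra_def)
  have minimal: "K = H" if "?C K" "K \<subseteq> H" for K
    using findim_dim_less[OF S(1), of H K] least[OF that(1)] that Hs S(2)
    by (force simp: hereditary_subalgebra_def)
  have sandwich: "(\<lambda>x. b * x * b) ` H = H" if b: "b \<in> H" "star b = b" "b \<noteq> 0" for b
  proof (rule minimal)
    have bD: "b \<in> D" using b Hs by blast
    show sub: "(\<lambda>x. b * x * b) ` H \<subseteq> H" using b Hs by auto
    have "csubspace ((\<lambda>x. b * x * b) ` H)"
      unfolding complex_space.subspace_def
    proof (intro conjI ballI allI)
      show "0 \<in> (\<lambda>x. b * x * b) ` H"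
        using complex_space.subspace_0[OF Hs(1)] by (intro image_eqI[of _ _ 0]) auto
    next
      fix x y assume "x \<in> (\<lambda>x. b * x * b) ` H" "y \<in> (\<lambda>x. b * x * b) ` H"
      then obtain x' y' where "x = b * x' * b" "y = b * y' * b" "x' \<in> H" "y' \<in> H" by blast
      then show "x + y \<in> (\<lambda>x. b * x * b) ` H"
        using complex_space.subspace_add[OF Hs(1)]
        by (intro image_eqI[of _ _ "x' + y'"]) (auto simp: algebra_simps)
    next
      fix c x assume "x \<in> (\<lambda>x. b * x * b) ` H"
      then obtain x' where "x = b * x' * b" "x' \<in> H" by blast
      then show "c *\<^sub>C x \<in> (\<lambda>x. b * x * b) ` H"
        using complex_space.subspace_scale[OF Hs(1)]
        by (intro image_eqI[of _ _ "c *\<^sub>C x'"]) (auto simp: mult_scaleC_left mult_scaleC_right)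
    qed
    moreover have "star x \<in> (\<lambda>x. b * x * b) ` H" if "x \<in> (\<lambda>x. b * x * b) ` H" for x
    proof -
      obtain x' where "x = b * x' * b" "x' \<in> H" using \<open>x \<in> _\<close> by blast
      then show ?thesis
        using Hs(3) b by (intro image_eqI[of _ _ "star x'"]) (auto simp: star_mult mult.assoc)
    qed
    moreover have "x * y \<in> (\<lambda>x. b * x * b) ` H"
      if "x \<in> (\<lambda>x. b * x * b) ` H" "y \<in> (\<lambda>x. b * x * b) ` H" for x y
    proof -
      obtain x' y' where "x = b * x' * b" "y = b * y' * b" "x' \<in> H" "y' \<in> H" using \<open>x \<in> _\<close> \<open>y \<in> _\<close> by blast
      then show ?thesis
        using Hs(5)[of x' "b * b" y'] Dm[OF bD bD]
        by (intro image_eqI[of _ _ "x' * (b * b) * y'"]) (auto simp: mult.assoc)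
    qed
    moreover have "x * d * y \<in> (\<lambda>x. b * x * b) ` H"
      if "x \<in> (\<lambda>x. b * x * b) ` H" "d \<in> D" "y \<in> (\<lambda>x. b * x * b) ` H" for x d y
    proof -
      obtain x' y' where "x = b * x' * b" "y = b * y' * b" "x' \<in> H" "y' \<in> H" using \<open>x \<in> _\<close> \<open>y \<in> _\<close> by blast
      then show ?thesis
        using Hs(5)[of x' "b * d * b" y'] Dm bD \<open>d \<in> D\<close>
        by (intro image_eqI[of _ _ "x' * (b * d * b) * y'"]) (auto simp: mult.assoc)
    qed
    moreover have "(\<lambda>x. b * x * b) ` H \<noteq> {0}"
    proof
      assume "(\<lambda>x. b * x * b) ` H = {0}"
      then have "b * b * b = 0" using b(1) by blast
      then have "star (b * b) * (b * b) = 0" by (simp add: star_mult b mult.assoc[symmetric])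
      then have "star b * b = 0" using b(2) by (simp only: star_mult_eq_0_iff)
      then show False using b(3) by (simp only: star_mult_eq_0_iff)
    qed
    moreover have "(\<lambda>x. b * x * b) ` H \<subseteq> D" "(\<lambda>x. b * x * b) ` H \<subseteq> H0" using sub H Hs(2) by auto
    ultimately show "?C ((\<lambda>x. b * x * b) ` H)"
      unfolding hereditary_subalgebra_def by (intro conjI ballI) simp_all
  qed
  have no_zero_div: "y = 0" if xy: "x \<in> H" "y \<in> H" "x \<noteq> 0" "x * y = 0" for x y
  proof (rule ccontr)
    assume "y \<noteq> 0"
    define a b where "a = star x * x" and "b = y * star y"
    have a: "a \<in> H" "star a = a" "a \<noteq> 0"
      using xy Hs by (auto simp: a_def star_mult star_star star_mult_eq_0_iff)
    have b: "b \<in> H" "star b = b" "b \<noteq> 0"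
      using xy Hs \<open>y \<noteq> 0\<close> star_mult_eq_0_iff[of "star y"]
      by (auto simp: b_def star_mult star_star) (metis star_star star_zero)
    obtain t where t: "a = b * t * b" using sandwich[OF b] a(1) by blast
    have "a * b = star x * (x * y) * star y" unfolding a_def b_def by (simp only: mult.assoc)
    also have "\<dots> = 0" unfolding xy(4) by simp
    finally have ab: "a * b = 0" .
    have "star a * a = a * b * t * b" unfolding a(2) by (subst (2) t) (simp only: mult.assoc)
    then have "star a * a = 0" by (simp add: ab)
    then show False using a(3) by (simp add: star_mult_eq_0_iff)
  qed
  have scalar: "\<exists>l. \<forall>y\<in>H. y * h = l *\<^sub>C y" if h: "h \<in> H" "h \<noteq> 0" for h
  proof -
    obtain l x where x: "x \<in> H" "x \<noteq> 0" "h * x = l *\<^sub>C x"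
      using exists_eigenvector[OF Hs(1) Hs(2)[unfolded S(2)] S(1) Hs(4)[OF h(1)] h] by blast
    have "y * h = l *\<^sub>C y" if "y \<in> H" for y
    proof (rule ccontr)
      assume ne: "y * h \<noteq> l *\<^sub>C y"
      have "y * h - l *\<^sub>C y \<in> H"
        using Hs(4)[OF that h(1)] that Hs(1)
        by (intro complex_space.subspace_diff complex_space.subspace_scale) auto
      moreover have "(y * h - l *\<^sub>C y) * x = 0"
        unfolding left_diff_distrib mult.assoc x(3) mult_scaleC_right mult_scaleC_left by simp
      ultimately show False using no_zero_div[of "y * h - l *\<^sub>C y" x] x ne by auto
    qed
    then show ?thesis by blast
  qed
  \<comment> \<open>Rescaling any nonzero element gives a right unit of \<open>H\<close>, which has to be self-adjoint.\<close>
  obtain h where h: "h \<in> H" "h \<noteq> 0"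
    using H complex_space.subspace_0[OF Hs(1)] by blast
  obtain l where l: "\<And>y. y \<in> H \<Longrightarrow> y * h = l *\<^sub>C y" using scalar[OF h] by blast
  have "l \<noteq> 0" using l[OF Hs(3)[OF h(1)]] h star_mult_eq_0_iff[of h] by auto
  define e where "e = inverse l *\<^sub>C h"
  have eH: "e \<in> H" using h Hs(1) by (simp add: e_def complex_space.subspace_scale)
  have e0: "e \<noteq> 0" using h \<open>l \<noteq> 0\<close> by (simp add: e_def complex_space.scale_eq_0_iff)
  have ye: "y * e = y" if "y \<in> H" for y
    using l[OF that] \<open>l \<noteq> 0\<close> by (simp add: e_def mult_scaleC_right scaleC_scaleC)
  have ey: "star e * y = y" if "y \<in> H" for y
    using ye[OF Hs(3)[OF that]] by (metis star_mult star_star)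
  have se: "star e = e" using ye[OF Hs(3)[OF eH]] ey[OF eH] by simp
  have pe: "projection e" using se ye[OF eH] by (simp add: projection_def)
  have "\<exists>c. e * d * e = c *\<^sub>C e" if d: "d \<in> D" for d
  proof (cases "e * d * e = 0")
    case False
    have g: "e * d * e \<in> H" using Hs(5) eH d by blast
    obtain c where "e * (e * d * e) = c *\<^sub>C e" using scalar[OF g False] eH by blast
    then have "e * d * e = c *\<^sub>C e" using ey[OF g] se by simp
    then show ?thesis by blast
  qed (auto intro: exI[of _ 0])
  then show ?thesis
    using eH e0 pe H Hs(2) unfolding minimal_projection_def by blast
qed


text \<open>Splitting off one minimal projection \<open>e\<close> leaves the hereditary subalgebra of all elements
  annihilated by \<open>e\<close>, whose dimension is smaller.\<close>

lemma orthogonal_minimal_projections: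
  fixes D :: "'a::cstar_algebra set"
  assumes D: "findim_star_subalgebra D" and "hereditary_subalgebra D H"
  shows "\<exists>(r::nat) p. (\<forall>i<r. p i \<in> H \<and> minimal_projection D (p i)) \<and>
    (\<forall>i<r. \<forall>j<r. i \<noteq> j \<longrightarrow> p i * p j = 0) \<and> (\<forall>x\<in>H. x * (\<Sum>i<r. p i) = x)"
  using assms(2)
proof (induction "complex_space.dim H" arbitrary: H rule: less_induct)
  case less
  obtain S where S: "finite S" "D = cspan S" using D by (auto simp: findim_star_subalgebra_def)
  have Hs: "csubspace H" "H \<subseteq> D" "\<And>x. x \<in> H \<Longrightarrow> star x \<in> H"
    "\<And>x y. x \<in> H \<Longrightarrow> y \<in> H \<Longrightarrow> x * y \<in> H" "\<And>x d y. x \<in> H \<Longrightarrow> d \<in> D \<Longrightarrow> y \<in> H \<Longrightarrow> x * d * y \<in> H"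
    using less.prems by (auto simp: hereditary_subalgebra_def)
  show ?case
  proof (cases "H = {0}")
    case True
    then show ?thesis by (intro exI[of _ 0] exI) simp
  next
    case False
    then obtain e where e: "e \<in> H" "minimal_projection D e"
      using hereditary_contains_minimal_projection[OF D less.prems] by blast
    have ee: "e * e = e" "star e = e" "e \<noteq> 0" using e by (auto simp: minimal_projection_def projection_def)
    define K where "K = {x \<in> H. e * x = 0 \<and> x * e = 0}"
    have K: "hereditary_subalgebra D K"
      unfolding hereditary_subalgebra_def
    proof (intro conjI ballI)
      show "csubspace K"
        using Hs(1) unfolding complex_space.subspace_def K_def
        by (auto simp: distrib_left distrib_right mult_scaleC_left mult_scaleC_right)
      show "K \<subseteq> D" using Hs(2) by (auto simp: K_def)
      show "star x \<in> K" if "x \<in> K" for x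
      proof -
        have "e * star x = star (x * e)" "star x * e = star (e * x)" by (simp_all add: star_mult ee)
        then show ?thesis using that Hs(3) by (simp add: K_def)
      qed
      show "x * y \<in> K" if "x \<in> K" "y \<in> K" for x y
        using that Hs(4) unfolding K_def by (auto simp: mult.assoc) (simp flip: mult.assoc)
      show "x * d * y \<in> K" if "x \<in> K" "d \<in> D" "y \<in> K" for x d y
        using that Hs(5) unfolding K_def by (auto simp: mult.assoc) (simp flip: mult.assoc)
    qed
    have "e \<notin> K" using ee by (auto simp: K_def)
    then have "complex_space.dim K < complex_space.dim H"
      using findim_dim_less[OF S(1), of H K] Hs(2) S(2) e(1) K
      by (auto simp: hereditary_subalgebra_def K_def)
    from less.hyps[OF this K] obtain r :: nat and p where p:
      "\<forall>i<r. p i \<in> K \<and> minimal_projection D (p i)"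
      "\<forall>i<r. \<forall>j<r. i \<noteq> j \<longrightarrow> p i * p j = 0" "\<forall>x\<in>K. x * (\<Sum>i<r. p i) = x"
      by (elim exE conjE)
    define q where "q = (\<Sum>i<r. p i)"
    have eq: "e * q = 0" "q * e = 0"
      using p(1) by (auto simp: q_def K_def sum_distrib_left sum_distrib_right)
    have sq: "star q = q"
      using p(1) by (auto simp: q_def star_sum minimal_projection_def projection_def)
    have unit: "x * (q + e) = x" if x: "x \<in> H" for x
    proof -
      \<comment> \<open>The part \<open>y\<close> of \<open>x\<close> to the right of \<open>1 - e\<close> satisfies \<open>y\<^sup>* y \<in> K\<close>, so the induction
        hypothesis applies to \<open>y\<^sup>* y\<close>, and the C*-identity transfers it to \<open>y\<close>.\<close>
      define y where "y = x - x * e"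
      have yH: "y \<in> H"
        unfolding y_def by (rule complex_space.subspace_diff[OF Hs(1) x Hs(4)[OF x e(1)]])
      have "y * e = 0" by (simp add: y_def left_diff_distrib mult.assoc ee)
      then have "star y * y \<in> K"
        using yH Hs(3,4) unfolding K_def
        by (auto simp: mult.assoc) (metis ee(2) mult.assoc mult_zero_left star_mult star_zero)
      then have yq: "star y * y * q = star y * y" using p(3) by (simp add: q_def)
      have "star (y - y * q) * (y - y * q) = (1 - q) * (star y * y - star y * y * q)"
        by (simp add: star_diff star_mult sq algebra_simps)
      then have "y * q = y" using yq by (simp add: star_mult_eq_0_iff)
      moreover have "y * q = x * q" by (simp add: y_def left_diff_distrib mult.assoc eq)
      ultimately have "x - x * e = x * q" by (simp add: y_def)
      then show ?thesis by (simp add: distrib_left flip: \<open>x - x * e = x * q\<close>)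
    qed
    let ?p = "p(r := e)"
    have "(\<Sum>i<Suc r. ?p i) = q + e" by (simp add: q_def)
    moreover have "\<forall>i<Suc r. ?p i \<in> H \<and> minimal_projection D (?p i)"
      using p(1) e by (auto simp: less_Suc_eq K_def)
    moreover have "\<forall>i<Suc r. \<forall>j<Suc r. i \<noteq> j \<longrightarrow> ?p i * ?p j = 0"
      using p(1,2) by (auto simp: less_Suc_eq K_def)
    ultimately show ?thesis using unit by (intro exI[of _ "Suc r"] exI[of _ ?p]) simp
  qed
qed

text \<open>For \<open>x = p x q\<close> minimality gives \<open>x x\<^sup>* = t p\<close> and \<open>x\<^sup>* x = t q\<close> with the same real \<open>t \<noteq> 0\<close>,
  and the task is to exclude \<open>t < 0\<close>. If \<open>p = q\<close> then \<open>x\<close> is a multiple of \<open>p\<close>. If \<open>p q = 0\<close> then the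
  self-adjoint element \<open>a = x + x\<^sup>*\<close> has the square \<open>t (p + q)\<close>; for \<open>t < 0\<close> the C*-identity would
  make \<open>a + i (-t)\<^sup>1\<^sup>/\<^sup>2 (p + q)\<close> vanish, so that \<open>a\<close> would not be self-adjoint.\<close>

lemma partial_isometry_between_minimal_projections:
  fixes D :: "'a::cstar_algebra set"
  assumes D: "findim_star_subalgebra D" and p: "minimal_projection D p" and q: "minimal_projection D q"
    and pq: "p = q \<or> p * q = 0" and x: "x \<in> D" "p * x * q = x" "x \<noteq> 0"
  shows "\<exists>v\<in>D. v * star v = p \<and> star v * v = q"
proof -
  have pp: "p * p = p" "star p = p" "p \<noteq> 0" "p \<in> D" and qq: "q * q = q" "star q = q" "q \<noteq> 0" "q \<in> D"
    using p q by (auto simp: minimal_projection_def projection_def)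
  have Dc: "star x \<in> D" "x * star x \<in> D" "star x * x \<in> D"
    using D x(1) by (auto simp: findim_star_subalgebra_def)
  have px: "p * x = x" "x * q = x"
    using x(2) pp qq by (metis mult.assoc)+
  have xp: "star x * p = star x" "q * star x = star x"
    using px pp qq by (metis star_mult)+
  obtain t where t: "x * star x = t *\<^sub>C p"
    using p Dc(2) px xp unfolding minimal_projection_def by (metis mult.assoc)
  obtain t' where t': "star x * x = t' *\<^sub>C q"
    using q Dc(3) px xp unfolding minimal_projection_def by (metis mult.assoc)
  have "t *\<^sub>C x = x * star x * x" by (simp add: t mult_scaleC_left px)
  also have "\<dots> = t' *\<^sub>C x" by (simp add: mult.assoc t' mult_scaleC_right px)
  finally have tt: "t' = t" using x(3) by (simp add: complex_space.scale_right_imp_eq)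
  have "star (x * star x) = x * star x" by (simp add: star_mult star_star)
  then have "cnj t *\<^sub>C p = t *\<^sub>C p" by (simp add: t star_scaleC pp)
  then have "cnj t = t" using pp(3) by (simp add: complex_space.scale_right_imp_eq)
  then obtain s where s: "t = complex_of_real s" by (metis Reals_cnj_iff Reals_cases)
  have xx: "x * star x = s *\<^sub>R p" "star x * x = s *\<^sub>R q"
    using t t' by (simp_all add: tt s scaleC_of_real)
  have "s \<noteq> 0" using xx(2) x(3) star_mult_eq_0_iff[of x] by auto
  have "s > 0"
  proof (rule ccontr)
    assume "\<not> s > 0"
    then have sneg: "s < 0" using \<open>s \<noteq> 0\<close> by simp
    define u where "u = sqrt (- s)"
    have uu: "u * u = - s" "u > 0" using sneg by (auto simp: u_def)
    from pq show False
    proof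
      assume "p = q"
      then obtain c where c: "x = c *\<^sub>C p"
        using p x(1,2) unfolding minimal_projection_def by metis
      have "star x * x = (cnj c * c) *\<^sub>C p"
        by (simp add: c star_scaleC mult_scaleC_left mult_scaleC_right scaleC_scaleC pp)
      also have "cnj c * c = complex_of_real ((cmod c)\<^sup>2)"
        by (metis complex_norm_square mult.commute)
      finally have "(cmod c)\<^sup>2 *\<^sub>R p = s *\<^sub>R p" using xx(2) \<open>p = q\<close> by (simp only: scaleC_of_real)
      then have "(cmod c)\<^sup>2 = s" using pp(3) by simp
      then show False using sneg zero_le_power2[of "cmod c"] by linarith
    next
      assume pq0: "p * q = 0"
      then have qp0: "q * p = 0" using pp qq by (metis star_mult star_zero)
      have x2: "x * x = 0" using px qp0 by (metis mult.assoc mult_zero_left mult_zero_right)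
      then have x3: "star x * star x = 0" by (metis star_mult star_zero)
      have pq2: "p * star x = 0" "x * p = 0" "q * x = 0" "star x * q = 0"
        using px xp pq0 qp0 by (metis mult.assoc mult_zero_left mult_zero_right)+
      define k where "k = \<i> * complex_of_real u"
      have k: "cnj k = - k" "k * k = complex_of_real s"
        using uu by (simp_all add: k_def algebra_simps flip: of_real_mult mult.assoc)
      define w where "w = x + star x + k *\<^sub>C (p + q)"
      have sw: "star w = x + star x - k *\<^sub>C (p + q)"
        by (simp add: w_def star_add star_scaleC star_star pp qq scaleC_minus_left k)
      have "star w * w = x * star x + star x * x - (k * k) *\<^sub>C (p + q)"
        unfolding sw unfolding w_def
        by (simp add: algebra_simps x2 x3 pq2 px xp pq0 qp0 mult_scaleC_left mult_scaleC_right
            scaleC_scaleC pp qq scaleC_add_right)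
      also have "\<dots> = 0" by (simp add: xx k scaleC_of_real algebra_simps)
      finally have w0: "w = 0" by (simp add: star_mult_eq_0_iff)
      then have "star w = 0" by simp
      then have "w - star w = 0" using w0 by simp
      then have "(k + k) *\<^sub>C (p + q) = 0"
        unfolding sw unfolding w_def scaleC_add_left by simp
      moreover have "k \<noteq> 0" using uu by (simp add: k_def)
      ultimately have "p + q = 0" by (simp add: complex_space.scale_eq_0_iff)
      then have "p * (p + q) = 0" by simp
      then show False using pp pq0 by (simp add: distrib_left)
    qed
  qed
  define v where "v = (1 / sqrt s) *\<^sub>R x"
  have "v \<in> D"
    using D x(1) unfolding v_def findim_star_subalgebra_def
    by (metis csubspace_imp_subspace subspace_scale)
  moreover have "v * star v = p" "star v * v = q"
    using \<open>s > 0\<close> by (simp_all add: v_def star_scaleR xx)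
  ultimately show ?thesis by blast
qed

text \<open>The matrix units of the block containing \<open>i\<close> and \<open>j\<close> are \<open>v i * star (v j)\<close>, where \<open>v i\<close>
  is a partial isometry from the chosen minimal projection of the block onto the projection
  with index \<open>i\<close>, and \<open>\<rho> i\<close> is the index of the chosen one.\<close>

lemma findim_matrix_units:
  fixes D :: "'a::cstar_algebra set"
  assumes D: "findim_star_subalgebra D"
  shows "\<exists>(r::nat) p v \<rho>.
    (\<forall>i<r. projection (p i) \<and> v i \<in> D \<and> \<rho> i < r \<and>
      v i * star (v i) = p i \<and> star (v i) * v i = p (\<rho> i)) \<and>
    (\<forall>i<r. \<forall>j<r. i \<noteq> j \<longrightarrow> p i * p j = 0) \<and>
    D \<subseteq> cspan {v i * star (v j) | i j. i < r \<and> j < r \<and> \<rho> i = \<rho> j}"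
proof -
  have Dc: "csubspace D" "\<And>x. x \<in> D \<Longrightarrow> star x \<in> D" "\<And>x y. x \<in> D \<Longrightarrow> y \<in> D \<Longrightarrow> x * y \<in> D"
    using D by (auto simp: findim_star_subalgebra_def)
  have "hereditary_subalgebra D D"
    using Dc by (auto simp: hereditary_subalgebra_def)
  then obtain r :: nat and p where p: "\<And>i. i < r \<Longrightarrow> minimal_projection D (p i)"
    "\<And>i j. i < r \<Longrightarrow> j < r \<Longrightarrow> i \<noteq> j \<Longrightarrow> p i * p j = 0" "\<And>x. x \<in> D \<Longrightarrow> x * (\<Sum>i<r. p i) = x"
    using orthogonal_minimal_projections[OF D, of D] by metis
  have pD: "projection (p i)" "p i \<in> D" "star (p i) = p i" "p i * p i = p i" if "i < r" for i
    using p(1)[OF that] by (auto simp: minimal_projection_def projection_def)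
  define q where "q = (\<Sum>i<r. p i)"
  have sq: "star q = q" using pD by (simp add: q_def star_sum)
  have xq: "x * q = x" if "x \<in> D" for x using p(3)[OF that] by (simp add: q_def)
  have qx: "q * x = x" if "x \<in> D" for x
    using xq[OF Dc(2)[OF that]] sq by (metis star_mult star_star)
  define eqv where "eqv i j \<longleftrightarrow> (\<exists>v\<in>D. v * star v = p i \<and> star v * v = p j)" for i j
  have refl: "eqv i i" if "i < r" for i
    unfolding eqv_def using pD[OF that] by (intro bexI[of _ "p i"]) auto
  have sym: "eqv j i" if "eqv i j" for i j
    using that Dc(2) unfolding eqv_def by (metis star_star)
  have trans: "eqv i k" if ij: "eqv i j" and jk: "eqv j k" and "i < r" "j < r" "k < r" for i j k
  proof -
    obtain v where v: "v \<in> D" "v * star v = p i" "star v * v = p j" using ij eqv_def by blast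
    obtain w where w: "w \<in> D" "w * star w = p j" "star w * w = p k" using jk eqv_def by blast
    have vp: "v * p j = v" using projection_star_mult(1)[OF _ v(3)] pD that by blast
    have pw: "star w * p j = star w"
      using projection_star_mult(1)[of "p j" "star w"] pD that w(2) by (simp add: star_star)
    have "v * w * star (v * w) = v * (w * star w) * star v"
      by (simp only: star_mult mult.assoc)
    then have a: "v * w * star (v * w) = p i" by (simp add: w v vp)
    have "star (v * w) * (v * w) = star w * (star v * v) * w"
      by (simp only: star_mult mult.assoc)
    then have b: "star (v * w) * (v * w) = p k" by (simp add: w v pw)
    show ?thesis unfolding eqv_def using a b Dc(3)[OF v(1) w(1)] by blast
  qed
  \<comment> \<open>Equivalent indices have the same set of candidates, hence the same chosen one.\<close>
  define \<rho> where "\<rho> i = (SOME j. j < r \<and> eqv i j)" for i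
  have \<rho>: "\<rho> i < r" "eqv i (\<rho> i)" if "i < r" for i
    using someI[of "\<lambda>j. j < r \<and> eqv i j" i] refl[OF that] that by (auto simp: \<rho>_def)
  have \<rho>eq: "\<rho> i = \<rho> j" if "eqv i j" "i < r" "j < r" for i j
  proof -
    have "(\<lambda>k. k < r \<and> eqv i k) = (\<lambda>k. k < r \<and> eqv j k)"
      using trans[of j i] trans[of i j] sym that by blast
    then show ?thesis by (simp add: \<rho>_def)
  qed
  have "\<forall>i. \<exists>v. i < r \<longrightarrow> v \<in> D \<and> v * star v = p i \<and> star v * v = p (\<rho> i)"
    using \<rho>(2) unfolding eqv_def by blast
  then obtain v where v: "\<And>i. i < r \<Longrightarrow> v i \<in> D" "\<And>i. i < r \<Longrightarrow> v i * star (v i) = p i"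
    "\<And>i. i < r \<Longrightarrow> star (v i) * v i = p (\<rho> i)"
    by metis
  let ?U = "{v i * star (v j) | i j. i < r \<and> j < r \<and> \<rho> i = \<rho> j}"
  have corner: "p i * x * p j \<in> cspan ?U" if x: "x \<in> D" and ij: "i < r" "j < r" for x i j
  proof (cases "p i * x * p j = 0")
    case True
    then show ?thesis by (simp add: complex_space.span_zero)
  next
    case False
    have "p i * (p i * x * p j) * p j = p i * x * p j"
      using pD[OF ij(1)] pD[OF ij(2)] by (metis mult.assoc)
    then have "eqv i j"
      unfolding eqv_def
      using partial_isometry_between_minimal_projections[OF D p(1)[OF ij(1)] p(1)[OF ij(2)], of "p i * x * p j"]
        p(2)[of i j] ij False Dc(3) pD(2) x by metis
    then have r: "\<rho> i = \<rho> j" using \<rho>eq ij by blast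
    have vp: "v i * p (\<rho> i) = v i"
      by (rule projection_star_mult(1)[OF pD(1)[OF \<rho>(1)[OF ij(1)]] v(3)[OF ij(1)]])
    have vpj: "p (\<rho> i) * star (v j) = star (v j)"
      unfolding r by (rule projection_star_mult(2)[OF pD(1)[OF \<rho>(1)[OF ij(2)]] v(3)[OF ij(2)]])
    have "star (v i) * x * v j \<in> D" by (intro Dc(2,3) v(1) x ij)
    then obtain c where c: "p (\<rho> i) * (star (v i) * x * v j) * p (\<rho> i) = c *\<^sub>C p (\<rho> i)"
      using p(1)[OF \<rho>(1)[OF ij(1)]] unfolding minimal_projection_def by blast
    have "p i * x * p j = v i * (star (v i) * x * v j) * star (v j)"
      unfolding v(2)[OF ij(1), symmetric] v(2)[OF ij(2), symmetric] by (simp only: mult.assoc)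
    also have "\<dots> = v i * (p (\<rho> i) * (star (v i) * x * v j) * p (\<rho> i)) * star (v j)"
      using vp vpj by (metis mult.assoc)
    also have "\<dots> = c *\<^sub>C (v i * star (v j))"
      unfolding c by (simp add: mult_scaleC_left mult_scaleC_right vp)
    also have "\<dots> \<in> cspan ?U"
      using r ij by (intro complex_space.span_scale complex_space.span_base) blast
    finally show ?thesis .
  qed
  have "D \<subseteq> cspan ?U"
  proof
    fix x assume x: "x \<in> D"
    have "x = q * x * q" using xq qx x by simp
    also have "\<dots> = (\<Sum>j<r. \<Sum>i<r. p i * x * p j)"
      by (simp add: q_def sum_distrib_left sum_distrib_right)
    also have "\<dots> \<in> cspan ?U"
      using corner[OF x] by (intro complex_space.span_sum) auto
    finally show "x \<in> cspan ?U" .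
  qed
  then show ?thesis using pD(1) v \<rho>(1) p(2)
    by (intro exI[of _ r] exI[of _ p] exI[of _ v] exI[of _ \<rho>]) simp
qed


section \<open>Perturbation of finite-dimensional subalgebras\<close>

text \<open>The Kuratowski lower limit of a sequence of subsets.\<close>

definition lower_limit :: "(nat \<Rightarrow> 'a::cstar_algebra set) \<Rightarrow> 'a set" where
  "lower_limit E = {b. \<exists>\<beta>. (\<forall>m. \<beta> m \<in> E m) \<and> \<beta> \<longlonglongrightarrow> b}"

text \<open>The projections are lifted one after the other. Compressing an approximant of the next one by
  the complement of the sum of those already lifted makes orthogonality exact, and by
  \<open>nearby_projection_annihilates\<close> it stays exact when the compression is replaced by a projection.\<close>

lemma lift_orthogonal_projections:
  fixes E :: "nat \<Rightarrow> 'a::cstar_algebra set" and r :: nat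
  assumes E: "\<And>m. closed_star_subalgebra (E m)"
    and "\<And>i. i < r \<Longrightarrow> projection (p i)" "\<And>i. i < r \<Longrightarrow> p i \<in> lower_limit E"
    and "\<And>i j. i < r \<Longrightarrow> j < r \<Longrightarrow> i \<noteq> j \<Longrightarrow> p i * p j = 0"
  shows "\<exists>f. (\<forall>i<r. f i \<longlonglongrightarrow> p i) \<and>
    (\<forall>\<^sub>F m in sequentially. \<forall>i<r. f i m \<in> E m \<and> projection (f i m) \<and>
      (\<forall>j<r. i \<noteq> j \<longrightarrow> f i m * f j m = 0))"
  using assms(2-)
proof (induction r)
  case 0
  then show ?case by simp
next
  case (Suc r)
  then have "\<exists>f. (\<forall>i<r. f i \<longlonglongrightarrow> p i) \<and>
    (\<forall>\<^sub>F m in sequentially. \<forall>i<r. f i m \<in> E m \<and> projection (f i m) \<and>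
      (\<forall>j<r. i \<noteq> j \<longrightarrow> f i m * f j m = 0))" by simp
  then obtain f where lim: "\<And>i. i < r \<Longrightarrow> f i \<longlonglongrightarrow> p i" and
    ev: "\<forall>\<^sub>F m in sequentially. \<forall>i<r. f i m \<in> E m \<and> projection (f i m) \<and>
      (\<forall>j<r. i \<noteq> j \<longrightarrow> f i m * f j m = 0)"
    by blast
  obtain \<beta> where \<beta>: "\<And>m. \<beta> m \<in> E m" "\<beta> \<longlonglongrightarrow> p r"
    using Suc.prems(2)[of r] by (auto simp: lower_limit_def)
  have pr: "projection (p r)" using Suc.prems(1) by simp
  define q where "q m = (\<Sum>i<r. f i m)" for m
  define c where "c m = (1/2) *\<^sub>R (\<beta> m + star (\<beta> m))" for m
  define b where "b m = c m - q m * c m - c m * q m + q m * c m * q m" for m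
  have qp: "(\<Sum>i<r. p i) * p r = 0" "p r * (\<Sum>i<r. p i) = 0"
    using Suc.prems(3) by (auto simp: sum_distrib_left sum_distrib_right)
  have "q \<longlonglongrightarrow> (\<Sum>i<r. p i)"
    unfolding q_def by (intro tendsto_sum lim) simp
  moreover have "c \<longlonglongrightarrow> (1/2) *\<^sub>R (p r + star (p r))"
    unfolding c_def by (intro tendsto_intros \<beta>)
  then have "c \<longlonglongrightarrow> p r" using pr by (simp add: projection_def flip: scaleR_2)
  ultimately have "b \<longlonglongrightarrow> p r - (\<Sum>i<r. p i) * p r - p r * (\<Sum>i<r. p i)
      + (\<Sum>i<r. p i) * p r * (\<Sum>i<r. p i)"
    unfolding b_def by (intro tendsto_intros)
  then have "b \<longlonglongrightarrow> p r" by (simp add: qp)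
  note np = nearby_projection_tendsto[OF this pr]
  define f' where "f' = f(r := \<lambda>m. nearby_projection (b m))"
  have "\<forall>i<Suc r. f' i \<longlonglongrightarrow> p i"
    using lim np(1) by (auto simp: f'_def less_Suc_eq)
  moreover have "\<forall>\<^sub>F m in sequentially. \<forall>i<Suc r. f' i m \<in> E m \<and> projection (f' i m) \<and>
      (\<forall>j<Suc r. i \<noteq> j \<longrightarrow> f' i m * f' j m = 0)"
    using ev np(2)
  proof eventually_elim
    case (elim m)
    have f: "f i m \<in> E m" "projection (f i m)" "star (f i m) = f i m" "f i m * f i m = f i m"
      if "i < r" for i using elim(1) that by (auto simp: projection_def)
    have ff: "f i m * f j m = 0" if "i < r" "j < r" "i \<noteq> j" for i j using elim(1) that by blast
    have q: "q m \<in> E m" "star (q m) = q m"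
      using f by (auto simp: q_def star_sum intro!: closed_star_subalgebraD[OF E])
    have c: "c m \<in> E m" "star (c m) = c m"
      using \<beta>(1)[of m] by (auto simp: c_def star_scaleR star_add star_star add.commute
          intro!: closed_star_subalgebraD[OF E])
    have bE: "b m \<in> E m" "star (b m) = b m"
      unfolding b_def using q c
      by (auto simp: star_add star_diff star_mult mult.assoc intro!: closed_star_subalgebraD[OF E])
    let ?g = "nearby_projection (b m)"
    have g: "?g \<in> E m" "projection ?g"
      using nearby_projection_mem[OF E bE(1) elim(2)] projection_nearby_projection[OF bE(2) elim(2)] by auto
    have fg: "f i m * ?g = 0" if "i < r" for i
    proof (rule nearby_projection_annihilates[OF _ elim(2)])
      have "f i m * q m = (\<Sum>j<r. if j = i then f i m else 0)"
        unfolding q_def sum_distrib_left using ff f(4) that by (intro sum.cong) auto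
      then have "f i m * q m = f i m" using that by simp
      then have "f i m * (q m * y) = f i m * y" for y by (metis mult.assoc)
      then show "f i m * b m = 0"
        by (simp add: b_def distrib_left right_diff_distrib mult.assoc)
    qed
    have gf: "?g * f i m = 0" if "i < r" for i
      using fg[OF that] g(2) f(3)[OF that] by (metis projection_def star_mult star_zero)
    show ?case
      using f g ff fg gf by (auto simp: f'_def less_Suc_eq)
  qed
  ultimately show ?case by blast
qed

lemma polar_part_tendsto:
  assumes "x \<longlonglongrightarrow> v" "f \<longlonglongrightarrow> star v * v"
  shows "(\<lambda>m. polar_part (f m) (x m)) \<longlonglongrightarrow> v"
    and "\<forall>\<^sub>F m in sequentially. norm (f m - star (x m) * x m) < 1"
proof -
  have "(\<lambda>m. f m - star (x m) * x m) \<longlonglongrightarrow> star v * v - star v * v"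
    by (intro tendsto_intros assms)
  then have z: "(\<lambda>m. f m - star (x m) * x m) \<longlonglongrightarrow> 0" by simp
  have "(\<lambda>m. x m * inv_sqrt (f m - star (x m) * x m)) \<longlonglongrightarrow> v * 1"
    by (intro tendsto_intros assms inv_sqrt_tendsto_1 z)
  then show "(\<lambda>m. polar_part (f m) (x m)) \<longlonglongrightarrow> v" by (simp add: polar_part_def)
  show "\<forall>\<^sub>F m in sequentially. norm (f m - star (x m) * x m) < 1"
    using order_tendstoD(2)[OF tendsto_norm_zero[OF z], of 1] by simp
qed

lemma polar_part_intertwines:
  assumes w: "norm (1 - star w * w) < 1" and g: "w * g = g' * w" "w * star g = star g' * w"
  shows "polar_part 1 w * g = g' * polar_part 1 w"
proof -
  have "star w * g' = star (star g' * w)" by (simp add: star_mult star_star)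
  also have "\<dots> = g * star w" unfolding g(2)[symmetric] by (simp add: star_mult star_star)
  finally have gw: "star w * g' = g * star w" .
  have "star w * w * g = star w * g' * w" by (simp add: mult.assoc g)
  also have "\<dots> = g * (star w * w)" by (simp add: gw mult.assoc)
  finally have "(1 - star w * w) * g = g * (1 - star w * w)"
    by (simp add: left_diff_distrib right_diff_distrib)
  then have "inv_sqrt (1 - star w * w) * g = g * inv_sqrt (1 - star w * w)"
    by (rule inv_sqrt_commute[OF w])
  then show ?thesis unfolding polar_part_def by (metis g(1) mult.assoc)
qed

text \<open>Lift the minimal projections \<open>p i\<close> to orthogonal projections \<open>f i\<close> in \<open>E m\<close>, and the partial
  isometries \<open>v i\<close> to partial isometries \<open>V i\<close> in \<open>E m\<close> with range below \<open>f i\<close> and source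
  \<open>f (\<rho> i)\<close>. Then \<open>w\<close>, the sum of all \<open>V i v i\<^sup>*\<close> completed by a term between the complements,
  tends to 1 and intertwines \<open>v i v j\<^sup>*\<close> with \<open>V i V j\<^sup>*\<close>. Since \<open>w\<^sup>* w\<close> commutes with the matrix
  units, the unitary in the polar decomposition of \<open>w\<close> is an intertwiner, too.\<close>

lemma asymptotic_unitary_conjugation:
  fixes D :: "'a::cstar_algebra set"
  assumes D: "findim_star_subalgebra D" and E: "\<And>m. closed_star_subalgebra (E m)"
    and DE: "D \<subseteq> lower_limit E"
  shows "\<exists>W. W \<longlonglongrightarrow> 1 \<and> (\<forall>\<^sub>F m in sequentially. star (W m) * W m = 1 \<and> W m * star (W m) = 1 \<and>
    (\<forall>x\<in>D. W m * x * star (W m) \<in> E m))"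
proof -
  from findim_matrix_units[OF D] obtain r :: nat and p v \<rho> where
    units: "\<forall>i<r. projection (p i) \<and> v i \<in> D \<and> \<rho> i < r \<and>
      v i * star (v i) = p i \<and> star (v i) * v i = p (\<rho> i)"
    and orth: "\<forall>i<r. \<forall>j<r. i \<noteq> j \<longrightarrow> p i * p j = 0"
    and span: "D \<subseteq> cspan {v i * star (v j) | i j. i < r \<and> j < r \<and> \<rho> i = \<rho> j}"
    by (elim exE conjE)
  have p: "projection (p i)" and v: "v i \<in> D" and \<rho>: "\<rho> i < r"
    and vv: "v i * star (v i) = p i" "star (v i) * v i = p (\<rho> i)" if "i < r" for i
    using units that by simp_all
  have pp: "p i * p j = 0" if "i < r" "j < r" "i \<noteq> j" for i j using orth that by simp
  have pD: "p i \<in> D" if "i < r" for i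
    using D v[OF that] vv(1)[OF that] unfolding findim_star_subalgebra_def by metis
  have pE: "p i \<in> lower_limit E" if "i < r" for i using pD[OF that] DE by blast
  have "\<exists>f. (\<forall>i<r. f i \<longlonglongrightarrow> p i) \<and> (\<forall>\<^sub>F m in sequentially. \<forall>i<r. f i m \<in> E m \<and>
      projection (f i m) \<and> (\<forall>j<r. i \<noteq> j \<longrightarrow> f i m * f j m = 0))"
    by (rule lift_orthogonal_projections) (simp_all add: E p pE pp)
  then obtain f where f: "\<forall>i<r. f i \<longlonglongrightarrow> p i" and
    fev: "\<forall>\<^sub>F m in sequentially. \<forall>i<r. f i m \<in> E m \<and> projection (f i m) \<and>
      (\<forall>j<r. i \<noteq> j \<longrightarrow> f i m * f j m = 0)"
    by (elim exE conjE)
  have "\<exists>\<beta>. (\<forall>m. \<beta> m \<in> E m) \<and> \<beta> \<longlonglongrightarrow> v i" if "i < r" for i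
    using v[OF that] DE unfolding lower_limit_def by blast
  then obtain \<beta> where \<beta>: "\<And>i m. i < r \<Longrightarrow> \<beta> i m \<in> E m" "\<And>i. i < r \<Longrightarrow> \<beta> i \<longlonglongrightarrow> v i"
    by metis
  define x where "x i m = f i m * \<beta> i m * f (\<rho> i) m" for i m
  define V where "V i m = polar_part (f (\<rho> i) m) (x i m)" for i m
  have pv: "p i * v i * p (\<rho> i) = v i" if "i < r" for i
    using projection_star_mult(1)[OF p[OF \<rho>[OF that]] vv(2)[OF that]] vv(1)[OF that] vv(2)[OF that]
    by (metis mult.assoc)
  have x: "x i \<longlonglongrightarrow> v i" if "i < r" for i
    using tendsto_mult[OF tendsto_mult[OF f[rule_format, OF that] \<beta>(2)[OF that]] f[rule_format, OF \<rho>[OF that]]]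
    by (simp add: x_def[abs_def] pv[OF that])
  have V: "V i \<longlonglongrightarrow> v i" and z: "\<forall>\<^sub>F m in sequentially. norm (f (\<rho> i) m - star (x i m) * x i m) < 1"
    if "i < r" for i
    using polar_part_tendsto[OF x[OF that], of "f (\<rho> i)"] f[rule_format, OF \<rho>[OF that]] vv(2)[OF that]
    by (auto simp: V_def[abs_def])
  have zev: "\<forall>\<^sub>F m in sequentially. \<forall>i\<in>{..<r}. norm (f (\<rho> i) m - star (x i m) * x i m) < 1"
    by (rule eventually_ball_finite) (use z in auto)
  define w where "w m = (\<Sum>i<r. V i m * star (v i)) + (1 - (\<Sum>i<r. V i m * star (V i m))) * (1 - (\<Sum>i<r. p i))" for m
  define q where "q = (\<Sum>i<r. p i)"
  have "p i * q = p i" if "i < r" for i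
  proof -
    have "p i * q = (\<Sum>j<r. if j = i then p i else 0)"
      unfolding q_def sum_distrib_left using pp p that by (intro sum.cong) (auto simp: projection_def)
    then show ?thesis using that by simp
  qed
  then have qq: "q * q = q" by (simp add: q_def sum_distrib_right)
  have "w \<longlonglongrightarrow> (\<Sum>i<r. v i * star (v i)) + (1 - (\<Sum>i<r. v i * star (v i))) * (1 - (\<Sum>i<r. p i))"
    unfolding w_def by (intro tendsto_intros V) auto
  also have "(\<Sum>i<r. v i * star (v i)) = q" using vv(1) by (simp add: q_def)
  also have "q + (1 - q) * (1 - (\<Sum>i<r. p i)) = 1"
    unfolding q_def[symmetric] by (simp add: algebra_simps qq)
  finally have w: "w \<longlonglongrightarrow> 1" .
  define W where "W m = polar_part 1 (w m)" for m
  have W: "W \<longlonglongrightarrow> 1" and wz: "\<forall>\<^sub>F m in sequentially. norm (1 - star (w m) * w m) < 1"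
    using polar_part_tendsto[OF w, of "\<lambda>_. 1"] by (auto simp: W_def[abs_def])
  have "(\<lambda>m. 1 - W m * star (W m)) \<longlonglongrightarrow> 1 - 1 * star 1"
    by (intro tendsto_intros W)
  then have "(\<lambda>m. norm (1 - W m * star (W m))) \<longlonglongrightarrow> norm (1 - 1 * star (1::'a))"
    by (rule tendsto_norm)
  from order_tendstoD(2)[OF this, of 1]
  have wn: "\<forall>\<^sub>F m in sequentially. norm (1 - W m * star (W m)) < 1" by simp
  have "\<forall>\<^sub>F m in sequentially. star (W m) * W m = 1 \<and> W m * star (W m) = 1 \<and>
    (\<forall>x\<in>D. W m * x * star (W m) \<in> E m)"
    using fev zev wz wn
  proof eventually_elim
    case (elim m)
    have one: "projection (1::'a)" by (simp add: projection_def)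
    have iso: "star (W m) * W m = 1"
      unfolding W_def by (rule polar_part_isometry[OF one _ elim(3)]) simp
    \<comment> \<open>The complement of the range projection of an isometry close to 1 has norm less than 1.\<close>
    have coiso: "W m * star (W m) = 1"
      using projection_norm_less_1[OF projection_complement[OF projection_star_mult(3)[OF one iso]] elim(4)]
      by simp
    have fm: "f i m \<in> E m" "projection (f i m)" "f i m * f i m = f i m" "star (f i m) = f i m"
      if "i < r" for i using elim(1) that by (auto simp: projection_def)
    have xf: "x i m * f (\<rho> i) m = x i m" if "i < r" for i
      using fm(3)[OF \<rho>[OF that]] by (simp add: x_def mult.assoc)
    have xE: "x i m \<in> E m" if "i < r" for i
      using fm(1) \<beta>(1) \<rho> that by (auto simp: x_def intro!: closed_star_subalgebraD[OF E])
    have VV: "star (V i m) * V i m = f (\<rho> i) m" if "i < r" for i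
      unfolding V_def using elim(2) that by (intro polar_part_isometry fm(2) \<rho> xf) auto
    have VE: "V i m \<in> E m" if "i < r" for i
      unfolding V_def using elim(2) that by (intro polar_part_mem E xE fm(2) \<rho> xf) auto
    have fV: "f i m * V i m = V i m" if "i < r" for i
      using fm(3)[OF that] by (simp add: V_def polar_part_def x_def mult.assoc[symmetric])
    have Vf: "V i m * f (\<rho> i) m = V i m" if "i < r" for i
      by (rule projection_star_mult(1)[OF fm(2)[OF \<rho>[OF that]] VV[OF that]])
    have V0: "star (V i m) * V j m = 0" if "i < r" "j < r" "i \<noteq> j" for i j
    proof -
      have "star (V i m) * V j m = star (f i m * V i m) * (f j m * V j m)" using fV that by simp
      also have "\<dots> = star (V i m) * (f i m * f j m) * V j m"
        using fm(4) that by (simp add: star_mult mult.assoc)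
      also have "f i m * f j m = 0" using elim(1) that by blast
      finally show ?thesis by simp
    qed
    have v0: "star (v i) * v j = 0" if "i < r" "j < r" "i \<noteq> j" for i j
    proof -
      note ps = projection_star_mult[OF p[OF \<rho>] vv(2)]
      have "star (v i) * p i = star (v i)"
        using ps(2)[OF that(1) that(1)] vv[OF that(1)] by (metis mult.assoc)
      moreover have "p j * v j = v j"
        using ps(1)[OF that(2) that(2)] vv[OF that(2)] by (metis mult.assoc)
      ultimately have "star (v i) * v j = star (v i) * (p i * p j) * v j"
        by (metis mult.assoc)
      then show ?thesis using pp that by simp
    qed
    have wv: "w m * v i = V i m * p (\<rho> i)" if i: "i < r" for i
    proof -
      have "(\<Sum>j<r. V j m * star (v j)) * v i = (\<Sum>j<r. if j = i then V i m * p (\<rho> i) else 0)"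
        unfolding sum_distrib_right using v0 vv(2) i
        by (intro sum.cong) (auto simp: mult.assoc)
      moreover have "(1 - q) * v i = 0"
      proof -
        have "q * v i = (\<Sum>j<r. p j * v i)" by (simp add: q_def sum_distrib_right)
        also have "\<dots> = (\<Sum>j<r. if j = i then v i else 0)"
        proof (intro sum.cong refl)
          fix j assume "j \<in> {..<r}"
          then have "p j * v i = v j * (star (v j) * v i)" using vv(1) by (simp flip: mult.assoc)
          then show "p j * v i = (if j = i then v i else 0)"
            using v0[of j i] i \<open>j \<in> _\<close> vv(2)[OF i] projection_star_mult(1)[OF p[OF \<rho>[OF i]] vv(2)[OF i]]
            by auto
        qed
        finally show ?thesis using i by (simp add: left_diff_distrib)
      qed
      ultimately show ?thesis
        using i unfolding w_def q_def[symmetric] by (simp add: distrib_right mult.assoc)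
    qed
    have Vw: "star (V i m) * w m = f (\<rho> i) m * star (v i)" if i: "i < r" for i
    proof -
      have "star (V i m) * (\<Sum>j<r. V j m * star (v j))
          = (\<Sum>j<r. if j = i then f (\<rho> i) m * star (v i) else 0)"
        unfolding sum_distrib_left using V0 VV i
        by (intro sum.cong) (auto simp: mult.assoc[symmetric])
      moreover have "star (V i m) * (\<Sum>j<r. V j m * star (V j m))
          = (\<Sum>j<r. if j = i then star (V i m) else 0)"
        unfolding sum_distrib_left using V0 VV i projection_star_mult(2)[OF fm(2)[OF \<rho>[OF i]] VV[OF i]]
        by (intro sum.cong) (auto simp: mult.assoc[symmetric])
      ultimately show ?thesis
        using i unfolding w_def by (simp add: distrib_left right_diff_distrib mult.assoc[symmetric])
    qed
    have gw: "w m * (v i * star (v j)) = V i m * star (V j m) * w m" if "i < r" "j < r" "\<rho> i = \<rho> j" for i j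
    proof -
      have "w m * (v i * star (v j)) = V i m * (p (\<rho> j) * star (v j))"
        using wv[OF that(1)] that(3) by (simp flip: mult.assoc)
      also have "\<dots> = V i m * star (v j)"
        using projection_star_mult(2)[OF p[OF \<rho>[OF that(2)]] vv(2)[OF that(2)]] by simp
      also have "\<dots> = V i m * f (\<rho> j) m * star (v j)" using Vf[OF that(1)] that(3) by simp
      also have "\<dots> = V i m * (star (V j m) * w m)" by (simp add: Vw[OF that(2)] mult.assoc)
      finally show ?thesis by (simp add: mult.assoc)
    qed
    have gen: "W m * (v i * star (v j)) * star (W m) \<in> E m" if ij: "i < r" "j < r" "\<rho> i = \<rho> j" for i j
    proof -
      have "W m * (v i * star (v j)) = V i m * star (V j m) * W m"
        unfolding W_def
        by (rule polar_part_intertwines[OF elim(3) gw[OF ij]])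
          (use gw[OF ij(2) ij(1)] ij(3) in \<open>simp add: star_mult star_star\<close>)
      then have "W m * (v i * star (v j)) * star (W m) = V i m * star (V j m)"
        by (simp add: mult.assoc coiso)
      then show ?thesis using VE ij by (auto intro!: closed_star_subalgebraD[OF E])
    qed
    have "csubspace {x. W m * x * star (W m) \<in> E m}"
      using closed_star_subalgebraD[OF E]
      by (auto simp: complex_space.subspace_def distrib_left distrib_right mult_scaleC_left mult_scaleC_right)
    then have "cspan {v i * star (v j) | i j. i < r \<and> j < r \<and> \<rho> i = \<rho> j} \<subseteq> {x. W m * x * star (W m) \<in> E m}"
      using gen by (intro complex_space.span_minimal) auto
    then show ?case using iso coiso span by blast
  qed
  then show ?thesis using W by blast
qed


section \<open>Inductive limits from asymptotically exhausting subalgebras\<close>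

lemma csubspace_vimage:
  fixes f :: "'a::cstar_algebra \<Rightarrow> 'b::cstar_algebra"
  assumes V: "csubspace V" and f: "\<And>x y. f (x + y) = f x + f y" "\<And>c x. f (c *\<^sub>C x) = c *\<^sub>C f x"
  shows "csubspace {x. f x \<in> V}"
proof -
  have f0: "f 0 = 0" using f(2)[of 0 0] by simp
  show ?thesis
    unfolding complex_space.subspace_def mem_Collect_eq f f0
    using V unfolding complex_space.subspace_def by simp
qed

lemma csubspace_image:
  fixes f :: "'a::cstar_algebra \<Rightarrow> 'b::cstar_algebra"
  assumes V: "csubspace V" and f: "\<And>x y. f (x + y) = f x + f y" "\<And>c x. f (c *\<^sub>C x) = c *\<^sub>C f x"
  shows "csubspace (f ` V)"
  unfolding complex_space.subspace_def
proof (intro conjI ballI allI)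
  have f0: "f 0 = 0" using f(2)[of 0 0] by simp
  show "0 \<in> f ` V" 
    using f0 complex_space.subspace_0[OF V] by (intro image_eqI[of _ f 0]) simp_all
next
  fix x y assume "x \<in> f ` V" "y \<in> f ` V"
  then obtain x' y' where "x = f x'" "y = f y'" "x' \<in> V" "y' \<in> V" by blast
  then show "x + y \<in> f ` V"
    by (intro image_eqI[of _ f "x' + y'"]) (simp_all add: f complex_space.subspace_add[OF V])
next
  fix c x assume "x \<in> f ` V"
  then obtain x' where "x = f x'" "x' \<in> V" by blast
  then show "c *\<^sub>C x \<in> f ` V"
    by (intro image_eqI[of _ f "c *\<^sub>C x'"]) (simp_all add: f complex_space.subspace_scale[OF V])
qed

lemma cspan_image:
  fixes f :: "'a::cstar_algebra \<Rightarrow> 'b::cstar_algebra"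
  assumes f: "\<And>x y. f (x + y) = f x + f y" "\<And>c x. f (c *\<^sub>C x) = c *\<^sub>C f x"
  shows "cspan (f ` S) = f ` cspan S"
proof
  show "cspan (f ` S) \<subseteq> f ` cspan S"
    by (rule complex_space.span_minimal[OF image_mono[OF complex_space.span_superset]
          csubspace_image[OF complex_space.subspace_span f]])
  have "cspan S \<subseteq> {x. f x \<in> cspan (f ` S)}"
    by (rule complex_space.span_minimal[OF _ csubspace_vimage[OF complex_space.subspace_span f]])
      (simp_all add: f complex_space.span_base subset_eq)
  then show "f ` cspan S \<subseteq> cspan (f ` S)" by blast
qed

lemma closure_csubspace:
  assumes "csubspace V"
  shows "csubspace (closure V)"
  unfolding complex_space.subspace_def
proof (intro conjI ballI allI)
  show "0 \<in> closure V"
    using complex_space.subspace_0[OF assms] closure_subset by blast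
next
  fix x y assume "x \<in> closure V" "y \<in> closure V"
  then obtain f g where "\<forall>m. f m \<in> V" "f \<longlonglongrightarrow> x" "\<forall>m. g m \<in> V" "g \<longlonglongrightarrow> y"
    unfolding closure_sequential by blast
  then show "x + y \<in> closure V"
    unfolding closure_sequential
    by (intro exI[of _ "\<lambda>m. f m + g m"]) (auto intro: tendsto_add complex_space.subspace_add[OF assms])
next
  fix c x assume "x \<in> closure V"
  then obtain f where "\<forall>m. f m \<in> V" "f \<longlonglongrightarrow> x"
    unfolding closure_sequential by blast
  then show "c *\<^sub>C x \<in> closure V"
    unfolding closure_sequential
    by (intro exI[of _ "\<lambda>m. c *\<^sub>C f m"])
      (auto intro: bounded_linear.tendsto[OF bounded_linear_scaleC] complex_space.subspace_scale[OF assms])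
qed

lemma findim_star_subalgebra_conjugate:
  assumes E: "findim_star_subalgebra E" and w: "w * star w = 1"
  shows "findim_star_subalgebra ((\<lambda>x. star w * x * w) ` E)"
proof -
  obtain S where S: "finite S" "E = cspan S" using E by (auto simp: findim_star_subalgebra_def)
  let ?f = "\<lambda>x. star w * x * w"
  have im: "?f ` E = cspan (?f ` S)"
    unfolding S(2) by (rule cspan_image[symmetric])
      (simp_all add: distrib_left distrib_right mult_scaleC_left mult_scaleC_right)
  have mult: "?f x * ?f y = ?f (x * y)" for x y
  proof -
    have "?f x * ?f y = star w * x * (w * star w) * y * w" by (simp only: mult.assoc)
    then show ?thesis by (simp add: w mult.assoc)
  qed
  have st: "star (?f x) = ?f (star x)" for x by (simp add: star_mult star_star mult.assoc)
  show ?thesis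
    unfolding findim_star_subalgebra_def
  proof (intro conjI ballI)
    show "csubspace (?f ` E)" unfolding im by (rule complex_space.subspace_span)
    show "\<exists>S. finite S \<and> ?f ` E = cspan S" using im S(1) by blast
    show "a * b \<in> ?f ` E" if ab: "a \<in> ?f ` E" "b \<in> ?f ` E" for a b
    proof -
      obtain x y where "a = ?f x" "b = ?f y" "x \<in> E" "y \<in> E" using ab by blast
      moreover from this have "x * y \<in> E" using E by (simp add: findim_star_subalgebra_def)
      ultimately show ?thesis by (intro image_eqI[of _ ?f "x * y"]) (simp_all only: mult)
    qed
    show "star a \<in> ?f ` E" if a: "a \<in> ?f ` E" for a
    proof -
      obtain x where "a = ?f x" "x \<in> E" using a by blast
      moreover from this have "star x \<in> E" using E by (simp add: findim_star_subalgebra_def)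
      ultimately show ?thesis by (intro image_eqI[of _ ?f "star x"]) (simp_all only: st)
    qed
  qed
qed

lemma findim_star_subalgebra_zero: "findim_star_subalgebra {0}"
  unfolding findim_star_subalgebra_def
  by (auto simp: complex_space.subspace_single_0 complex_space.span_empty intro: exI[of _ "{}"])

text \<open>The unitary conjugations that make the subalgebras nested tend to the identity, so a later
  member of the sequence, conjugated, contains the algebra built so far and still
  approximates the finite set prescribed at that stage.\<close>

theorem AF_algebra_if_asymptotically_exhausted:
  fixes E :: "nat \<Rightarrow> 'a::cstar_algebra set"
  assumes E: "\<And>m. findim_star_subalgebra (E m)" and lim: "lower_limit E = UNIV"
  shows "AF_algebra TYPE('a)"
proof -
  have "\<exists>S. finite S \<and> E m = cspan S" for m
    using E[of m] unfolding findim_star_subalgebra_def by blast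
  then obtain S where S: "\<And>m. finite (S m)" "\<And>m. E m = cspan (S m)" by metis
  let ?T = "\<lambda>k. \<Union>j\<le>k. S j"
  have step: "\<exists>D'. findim_star_subalgebra D' \<and> D \<subseteq> D' \<and> (\<forall>t\<in>?T k. \<exists>d\<in>D'. norm (d - t) < 1 / Suc k)"
    if D: "findim_star_subalgebra D" for D and k :: nat
  proof -
    have "D \<subseteq> lower_limit E" by (simp add: lim)
    from asymptotic_unitary_conjugation[OF D findim_closed_star_subalgebra[OF E] this]
    obtain W where W: "W \<longlonglongrightarrow> 1" and
      ev: "\<forall>\<^sub>F m in sequentially. star (W m) * W m = 1 \<and> W m * star (W m) = 1 \<and>
        (\<forall>x\<in>D. W m * x * star (W m) \<in> E m)"
      by (elim exE conjE)
    have "\<forall>t. \<exists>\<beta>. (\<forall>m. \<beta> m \<in> E m) \<and> \<beta> \<longlonglongrightarrow> t"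
      using lim by (auto simp: lower_limit_def)
    then obtain \<beta> where \<beta>: "\<And>t m. \<beta> t m \<in> E m" "\<And>t. \<beta> t \<longlonglongrightarrow> t" by metis
    have "\<forall>\<^sub>F m in sequentially. norm (star (W m) * \<beta> t m * W m - t) < 1 / Suc k" for t
    proof -
      have "(\<lambda>m. norm (star (W m) * \<beta> t m * W m - t)) \<longlonglongrightarrow> norm (star 1 * t * 1 - t)"
        by (intro tendsto_intros W \<beta>)
      from order_tendstoD(2)[OF this, of "1 / Suc k"] show ?thesis by simp
    qed
    then have "\<forall>\<^sub>F m in sequentially. \<forall>t\<in>?T k. norm (star (W m) * \<beta> t m * W m - t) < 1 / Suc k"
      using S(1) by (intro eventually_ball_finite) auto
    from eventually_happens[OF eventually_conj[OF ev this]]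
    obtain m where m: "star (W m) * W m = 1" "W m * star (W m) = 1"
      "\<forall>x\<in>D. W m * x * star (W m) \<in> E m"
      "\<forall>t\<in>?T k. norm (star (W m) * \<beta> t m * W m - t) < 1 / Suc k"
      by (auto simp only: sequentially_bot)
    let ?D = "(\<lambda>x. star (W m) * x * W m) ` E m"
    have "x \<in> ?D" if "x \<in> D" for x
    proof (rule image_eqI[OF _ m(3)[rule_format, OF that]])
      have "star (W m) * (W m * x * star (W m)) * W m = (star (W m) * W m) * x * (star (W m) * W m)"
        by (simp only: mult.assoc)
      then show "x = star (W m) * (W m * x * star (W m)) * W m" by (simp add: m(1))
    qed
    moreover have "\<exists>d\<in>?D. norm (d - t) < 1 / Suc k" if "t \<in> ?T k" for t
      using m(4) that \<beta>(1) by blast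
    ultimately show ?thesis
      using findim_star_subalgebra_conjugate[OF E m(2), of m] by blast
  qed
  have "\<exists>D. \<forall>k. findim_star_subalgebra (D k) \<and>
      (D k \<subseteq> D (Suc k) \<and> (\<forall>t\<in>?T k. \<exists>d\<in>D (Suc k). norm (d - t) < 1 / Suc k))"
    by (intro dependent_nat_choice[of "\<lambda>_. findim_star_subalgebra"
        "\<lambda>k D D'. D \<subseteq> D' \<and> (\<forall>t\<in>?T k. \<exists>d\<in>D'. norm (d - t) < 1 / Suc k)"])
      (use findim_star_subalgebra_zero step in auto)
  then obtain D where DD: "\<forall>k. findim_star_subalgebra (D k) \<and>
      (D k \<subseteq> D (Suc k) \<and> (\<forall>t\<in>?T k. \<exists>d\<in>D (Suc k). norm (d - t) < 1 / Suc k))"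
    by (elim exE)
  have D: "findim_star_subalgebra (D k)" "D k \<subseteq> D (Suc k)"
    and app: "\<forall>t\<in>?T k. \<exists>d\<in>D (Suc k). norm (d - t) < 1 / Suc k" for k
    using DD[THEN spec, THEN conjunct1] DD[THEN spec, THEN conjunct2, THEN conjunct1]
      DD[THEN spec, THEN conjunct2, THEN conjunct2] by fast+
  have mono: "D j \<subseteq> D k" if "j \<le> k" for j k
    using lift_Suc_mono_le[of D, OF D(2) that] .
  have "csubspace (\<Union>k. D k)"
    unfolding complex_space.subspace_def
  proof (intro conjI ballI allI)
    have sub: "csubspace (D k)" for k using D(1) by (simp add: findim_star_subalgebra_def)
    show "0 \<in> (\<Union>k. D k)" using complex_space.subspace_0[OF sub] by blast
    show "x + y \<in> (\<Union>k. D k)" if xy: "x \<in> (\<Union>k. D k)" "y \<in> (\<Union>k. D k)" for x y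
    proof -
      obtain j k where "x \<in> D j" "y \<in> D k" using xy by blast
      then have "x \<in> D (max j k)" "y \<in> D (max j k)" using mono[of j "max j k"] mono[of k "max j k"] by auto
      then show ?thesis using complex_space.subspace_add[OF sub] by blast
    qed
    show "c *\<^sub>C x \<in> (\<Union>k. D k)" if "x \<in> (\<Union>k. D k)" for c x
      using that complex_space.subspace_scale[OF sub] by blast
  qed
  then have cl: "csubspace (closure (\<Union>k. D k))" by (rule closure_csubspace)
  have "S j \<subseteq> closure (\<Union>k. D k)" for j
  proof
    fix t assume t: "t \<in> S j"
    show "t \<in> closure (\<Union>k. D k)"
      unfolding closure_approachable
    proof (intro allI impI)
      fix e :: real assume "e > 0"
      then obtain N where N: "1 / Suc N < e" using nat_approx_posE by blast
      let ?k = "max j N"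
      obtain d where d: "d \<in> D (Suc ?k)" "norm (d - t) < 1 / Suc ?k"
        using app[of ?k] t by (meson UN_I atMost_iff max.cobounded1)
      moreover have "1 / real (Suc ?k) \<le> 1 / real (Suc N)" by (intro divide_left_mono) auto
      ultimately show "\<exists>y\<in>\<Union>k. D k. dist y t < e" using N by (force simp: dist_norm)
    qed
  qed
  then have "E j \<subseteq> closure (\<Union>k. D k)" for j
    unfolding S(2) by (rule complex_space.span_minimal[OF _ cl])
  then have "x \<in> closure (\<Union>k. D k)" for x
    using lim closed_sequentially[OF closed_closure[of "\<Union>k. D k"]] unfolding lower_limit_def
    by blast
  then have "closure (\<Union>k. D k) = UNIV" by blast
  then show ?thesis using D unfolding AF_algebra_def by blast
qed


lemma lower_limitI_eventually:
  assumes "\<forall>\<^sub>F m in sequentially. \<beta> m \<in> E m" "\<beta> \<longlonglongrightarrow> b" "\<And>m. 0 \<in> E m"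
  shows "b \<in> lower_limit E"
proof -
  let ?\<gamma> = "\<lambda>m. if \<beta> m \<in> E m then \<beta> m else 0"
  have "\<forall>\<^sub>F m in sequentially. \<beta> m = ?\<gamma> m" using assms(1) by eventually_elim simp
  with assms(2) have l: "?\<gamma> \<longlonglongrightarrow> b" by (rule Lim_transform_eventually)
  have "\<forall>m. ?\<gamma> m \<in> E m" using assms(3) by simp
  with l show ?thesis unfolding lower_limit_def by (intro CollectI exI[of _ ?\<gamma>] conjI)
qed

text \<open>Distances vary continuously, so this form makes the closedness of the lower limit visible.\<close>

lemma lower_limit_iff_infdist:
  assumes "\<And>m. E m \<noteq> {}"
  shows "b \<in> lower_limit E \<longleftrightarrow> (\<lambda>m. infdist b (E m)) \<longlonglongrightarrow> 0"
proof
  assume "b \<in> lower_limit E"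
  then obtain \<beta> where \<beta>: "\<And>m. \<beta> m \<in> E m" "\<beta> \<longlonglongrightarrow> b" by (auto simp: lower_limit_def)
  have "(\<lambda>m. dist b (\<beta> m)) \<longlonglongrightarrow> dist b b" by (intro tendsto_intros \<beta>)
  then have "(\<lambda>m. dist b (\<beta> m)) \<longlonglongrightarrow> 0" by simp
  then show "(\<lambda>m. infdist b (E m)) \<longlonglongrightarrow> 0"
    by (rule Lim_null_comparison[rotated]) (simp add: infdist_le \<beta>(1) infdist_nonneg)
next
  assume lim: "(\<lambda>m. infdist b (E m)) \<longlonglongrightarrow> 0"
  have "\<exists>y\<in>E m. dist b y < infdist b (E m) + inverse (real (Suc m))" for m
  proof -
    have "Inf (dist b ` E m) < infdist b (E m) + inverse (real (Suc m))"
      using assms by (simp add: infdist_def)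
    from cInf_lessD[OF _ this] show ?thesis using assms by blast
  qed
  then obtain \<beta> where \<beta>: "\<And>m. \<beta> m \<in> E m" "\<And>m. dist b (\<beta> m) < infdist b (E m) + inverse (real (Suc m))"
    by metis
  have "(\<lambda>m. infdist b (E m) + inverse (real (Suc m))) \<longlonglongrightarrow> 0 + 0"
    by (intro tendsto_add lim LIMSEQ_inverse_real_of_nat)
  then have "(\<lambda>m. dist (\<beta> m) b) \<longlonglongrightarrow> 0"
    by (intro Lim_null_comparison[of "\<lambda>m. dist (\<beta> m) b"])
      (auto simp: dist_commute less_imp_le[OF \<beta>(2)] simp del: of_nat_Suc)
  then have "\<beta> \<longlonglongrightarrow> b" by (rule tendsto_dist_iff[THEN iffD2])
  then show "b \<in> lower_limit E" using \<beta>(1) unfolding lower_limit_def by blast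
qed

lemma closed_star_subalgebra_lower_limit:
  fixes E :: "nat \<Rightarrow> 'a::cstar_algebra set"
  assumes E: "\<And>m. closed_star_subalgebra (E m)"
  shows "closed_star_subalgebra (lower_limit E)"
proof -
  note D = closed_star_subalgebraD[OF E]
  have ne: "E m \<noteq> {}" for m using D(1)[of m] by blast
  have "b \<in> lower_limit E" if b: "b \<in> closure (lower_limit E)" for b
    unfolding lower_limit_iff_infdist[OF ne]
  proof (rule LIMSEQ_I)
    fix e :: real assume "e > 0"
    then obtain c where c: "c \<in> lower_limit E" "dist c b < e / 2"
      using b unfolding closure_approachable by (meson half_gt_zero)
    then obtain N where N: "\<And>m. m \<ge> N \<Longrightarrow> norm (infdist c (E m) - 0) < e / 2"
      using LIMSEQ_D[of "\<lambda>m. infdist c (E m)" 0 "e / 2"] \<open>e > 0\<close>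
      unfolding lower_limit_iff_infdist[OF ne] by auto
    show "\<exists>N. \<forall>m\<ge>N. norm (infdist b (E m) - 0) < e"
    proof (intro exI allI impI)
      fix m assume "m \<ge> N"
      have "infdist b (E m) \<le> infdist c (E m) + dist b c" by (rule infdist_triangle)
      then show "norm (infdist b (E m) - 0) < e"
        using N[OF \<open>m \<ge> N\<close>] c(2) by (simp add: infdist_nonneg dist_commute)
    qed
  qed
  then have "closed (lower_limit E)" by (metis closure_subset closure_subset_eq subsetI)
  moreover have "csubspace (lower_limit E)"
    unfolding complex_space.subspace_def
  proof (intro conjI ballI allI)
    show "0 \<in> lower_limit E" unfolding lower_limit_def using D(1) by (auto intro: exI[of _ "\<lambda>_. 0"])
    show "x + y \<in> lower_limit E" if xy: "x \<in> lower_limit E" "y \<in> lower_limit E" for x y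
    proof -
      obtain f g where "\<forall>m. f m \<in> E m" "f \<longlonglongrightarrow> x" "\<forall>m. g m \<in> E m" "g \<longlonglongrightarrow> y"
        using xy unfolding lower_limit_def by blast
      then show ?thesis
        unfolding lower_limit_def by (auto intro!: exI[of _ "\<lambda>m. f m + g m"] D(2) tendsto_add)
    qed
    show "c *\<^sub>C x \<in> lower_limit E" if x: "x \<in> lower_limit E" for c x
    proof -
      obtain f where "\<forall>m. f m \<in> E m" "f \<longlonglongrightarrow> x" using x unfolding lower_limit_def by blast
      then show ?thesis
        unfolding lower_limit_def
        by (auto intro!: exI[of _ "\<lambda>m. c *\<^sub>C f m"] D(7) bounded_linear.tendsto[OF bounded_linear_scaleC])
    qed
  qed
  moreover have "x * y \<in> lower_limit E" if xy: "x \<in> lower_limit E" "y \<in> lower_limit E" for x y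
  proof -
    obtain f g where "\<forall>m. f m \<in> E m" "f \<longlonglongrightarrow> x" "\<forall>m. g m \<in> E m" "g \<longlonglongrightarrow> y"
      using xy unfolding lower_limit_def by blast
    then show ?thesis
      unfolding lower_limit_def by (auto intro!: exI[of _ "\<lambda>m. f m * g m"] D(4) tendsto_mult)
  qed
  moreover have "star x \<in> lower_limit E" if x: "x \<in> lower_limit E" for x
  proof -
    obtain f where "\<forall>m. f m \<in> E m" "f \<longlonglongrightarrow> x" using x unfolding lower_limit_def by blast
    then show ?thesis
      unfolding lower_limit_def by (auto intro!: exI[of _ "\<lambda>m. star (f m)"] D(5) tendsto_star)
  qed
  ultimately show ?thesis unfolding closed_star_subalgebra_def by blast
qed

lemma findim_star_subalgebra_cspan:
  fixes T :: "'a::cstar_algebra set"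
  assumes "finite T" and mult: "\<And>x y. x \<in> T \<Longrightarrow> y \<in> T \<Longrightarrow> x * y \<in> cspan T"
    and st: "\<And>x. x \<in> T \<Longrightarrow> star x \<in> cspan T"
  shows "findim_star_subalgebra (cspan T)"
proof -
  note span = complex_space.subspace_span[of T]
  have left: "x * b \<in> cspan T" if x: "x \<in> T" and b: "b \<in> cspan T" for x b
  proof -
    have "cspan T \<subseteq> {b. x * b \<in> cspan T}"
      by (rule complex_space.span_minimal[OF _ csubspace_vimage[OF span]])
        (auto simp: distrib_left mult_scaleC_right mult[OF x])
    then show ?thesis using b by blast
  qed
  have 1: "a * b \<in> cspan T" if a: "a \<in> cspan T" and b: "b \<in> cspan T" for a b
  proof -
    have "cspan T \<subseteq> {a. a * b \<in> cspan T}"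
      by (rule complex_space.span_minimal[OF _ csubspace_vimage[OF span]])
        (auto simp: distrib_right mult_scaleC_left left[OF _ b])
    then show ?thesis using a by blast
  qed
  have "csubspace {a. star a \<in> cspan T}"
    using span by (simp add: complex_space.subspace_def star_add star_scaleC)
  then have "cspan T \<subseteq> {a. star a \<in> cspan T}"
    using st by (intro complex_space.span_minimal) auto
  then show ?thesis
    unfolding findim_star_subalgebra_def using assms(1) 1 span by blast
qed

lemma projection_in_dense_union:
  fixes B :: "nat \<Rightarrow> 'a::cstar_algebra set"
  assumes B: "\<And>k. findim_star_subalgebra (B k)" "\<And>k. B k \<subseteq> B (Suc k)" "closure (\<Union>k. B k) = UNIV"
    and e: "projection e" and eps: "\<epsilon> > 0"
  shows "\<exists>k\<ge>m. \<exists>q\<in>B k. projection q \<and> norm (q - e) < \<epsilon>"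
proof -
  have "e \<in> closure (\<Union>k. B k)" using B(3) by simp
  then obtain b where b: "\<And>l. b l \<in> (\<Union>k. B k)" "b \<longlonglongrightarrow> e"
    unfolding closure_sequential by blast
  define c where "c l = (1/2) *\<^sub>R (b l + star (b l))" for l
  have "c \<longlonglongrightarrow> (1/2) *\<^sub>R (e + star e)" unfolding c_def by (intro tendsto_intros b)
  then have "c \<longlonglongrightarrow> e" using e by (simp add: projection_def flip: scaleR_2)
  note np = nearby_projection_tendsto[OF this e]
  have "(\<lambda>l. norm (nearby_projection (c l) - e)) \<longlonglongrightarrow> norm (e - e)" by (intro tendsto_intros np)
  from order_tendstoD(2)[OF this, of \<epsilon>]
  have "\<forall>\<^sub>F l in sequentially. norm (nearby_projection (c l) - e) < \<epsilon>" using eps by simp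
  then obtain l where l: "norm (nearby_projection (c l) - e) < \<epsilon>" "norm (4 *\<^sub>R (c l - c l * c l)) < 1"
    using eventually_happens[OF eventually_conj[OF _ np(2)]] by force
  obtain k where "b l \<in> B k" using b(1) by blast
  then have "b l \<in> B (max k m)" using lift_Suc_mono_le[of B k "max k m", OF B(2)] by auto
  then have cB: "c l \<in> B (max k m)"
    unfolding c_def by (auto intro!: closed_star_subalgebraD[OF findim_closed_star_subalgebra[OF B(1)]])
  have "star (c l) = c l" by (simp add: c_def star_scaleR star_add star_star add.commute)
  from projection_nearby_projection[OF this l(2)]
    nearby_projection_mem[OF findim_closed_star_subalgebra[OF B(1)] cB l(2)] l(1)
  show ?thesis by (intro exI[of _ "max k m"]) auto
qed


section \<open>Asymptotic equality of sequences\<close>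

definition asymptotic :: "(nat \<Rightarrow> 'a::real_normed_algebra) \<Rightarrow> (nat \<Rightarrow> 'a) \<Rightarrow> bool" (infix "\<doteq>" 50) where
  "x \<doteq> y \<longleftrightarrow> (\<lambda>m. x m - y m) \<longlonglongrightarrow> 0"

lemma asymptotic_refl [simp]: "x \<doteq> x"
  by (simp add: asymptotic_def)

lemma asymptotic_sym: "x \<doteq> y \<Longrightarrow> y \<doteq> x"
  unfolding asymptotic_def using tendsto_minus by fastforce

lemma asymptotic_trans [trans]: "x \<doteq> y \<Longrightarrow> y \<doteq> z \<Longrightarrow> x \<doteq> z"
  unfolding asymptotic_def using tendsto_add by fastforce

lemma Bseq_algebra_mult:
  fixes x y :: "nat \<Rightarrow> 'a::real_normed_algebra"
  assumes "Bseq x" "Bseq y"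
  shows "Bseq (\<lambda>m. x m * y m)"
proof -
  obtain K where K: "K > 0" "\<And>m. norm (x m) \<le> K" using assms(1) unfolding Bseq_def by blast
  obtain L where L: "\<And>m. norm (y m) \<le> L" using assms(2) unfolding Bseq_def by blast
  have "norm (x m * y m) \<le> K * L" for m
    using norm_mult_ineq[of "x m" "y m"] mult_mono[OF K(2)[of m] L[of m]] K(1) by simp
  then show ?thesis by (rule BseqI')
qed

lemma asymptotic_eq_trans [trans]:
  "x = y \<Longrightarrow> y \<doteq> z \<Longrightarrow> x \<doteq> z" "x \<doteq> y \<Longrightarrow> y = z \<Longrightarrow> x \<doteq> z"
  by simp_all

lemma asymptotic_sum:
  "(\<And>j. j \<in> J \<Longrightarrow> x j \<doteq> y j) \<Longrightarrow> (\<lambda>m. \<Sum>j\<in>J. x j m) \<doteq> (\<lambda>m. \<Sum>j\<in>J. y j m)"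
  unfolding asymptotic_def using tendsto_sum[of J "\<lambda>j m. x j m - y j m" "\<lambda>_. 0"]
  by (simp add: sum_subtractf)

lemma asymptotic_mult:
  assumes "x \<doteq> x'" "y \<doteq> y'" "Bseq x" "Bseq y'"
  shows "(\<lambda>m. x m * y m) \<doteq> (\<lambda>m. x' m * y' m)"
proof -
  have "Zfun (\<lambda>m. x m * (y m - y' m)) sequentially" "Zfun (\<lambda>m. (x m - x' m) * y' m) sequentially"
    using assms by (auto simp: asymptotic_def tendsto_Zfun_iff
        intro: bounded_bilinear.Bfun_prod_Zfun[OF bounded_bilinear_mult]
          bounded_bilinear.Zfun_prod_Bfun[OF bounded_bilinear_mult])
  from Zfun_add[OF this] show ?thesis
    by (simp add: asymptotic_def tendsto_Zfun_iff algebra_simps)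
qed

lemma asymptotic_mult_const:
  "x \<doteq> y \<Longrightarrow> (\<lambda>m. a * x m * b) \<doteq> (\<lambda>m. a * y m * b)"
  unfolding asymptotic_def using tendsto_mult_right_zero[THEN tendsto_mult_left_zero]
  by (fastforce simp flip: left_diff_distrib right_diff_distrib)

lemma asymptotic_star: "x \<doteq> y \<Longrightarrow> (\<lambda>m. star (x m :: 'a::cstar_algebra)) \<doteq> (\<lambda>m. star (y m))"
  unfolding asymptotic_def using tendsto_star[of "\<lambda>m. x m - y m" 0 sequentially] by (simp add: star_diff)

lemma asymptotic_Bseq:
  assumes "x \<doteq> y" "Bseq y"
  shows "Bseq x"
proof -
  have "Bseq (\<lambda>m. x m - y m)"
    using assms(1) unfolding asymptotic_def by (intro convergent_imp_Bseq convergentI)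
  then obtain K where K: "\<And>m. norm (x m - y m) \<le> K" unfolding Bseq_def by blast
  obtain L where L: "\<And>m. norm (y m) \<le> L" using assms(2) unfolding Bseq_def by blast
  have "norm (x m) \<le> K + L" for m
    using norm_triangle_ineq[of "x m - y m" "y m"] K[of m] L[of m] by simp
  then show ?thesis by (rule BseqI')
qed

lemma asymptotic_tendsto: "x \<doteq> y \<Longrightarrow> y \<longlonglongrightarrow> l \<Longrightarrow> x \<longlonglongrightarrow> l"
  unfolding asymptotic_def using tendsto_add by fastforce

lemma asymptoticI_norm:
  assumes "\<forall>\<^sub>F m in sequentially. norm (x m - y m) \<le> inverse (real (Suc m))"
  shows "x \<doteq> y"
  unfolding asymptotic_def
  by (rule Lim_null_comparison[OF assms LIMSEQ_inverse_real_of_nat])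


section \<open>Covariant pairs\<close>

lemma covariant_pair_powers:
  fixes i :: "'a::cstar_algebra \<Rightarrow> 'b::cstar_algebra"
  assumes u: "star u * u = 1" "u * star u = 1" "u ^ n = 1"
    and cov: "\<And>a. u * i a = i (\<alpha> a) * u"
  shows "star (u ^ j) * u ^ j = 1" "u ^ j * star (u ^ j) = 1"
    "u ^ j * i a = i ((\<alpha> ^^ j) a) * u ^ j"
    "j \<le> n \<Longrightarrow> star (u ^ j) * i a * u ^ j = i ((\<alpha> ^^ (n - j)) a)"
proof -
  show 1: "star (u ^ j) * u ^ j = 1" for j
  proof (induction j)
    case (Suc j)
    have "star (u ^ Suc j) * u ^ Suc j = star (u ^ j) * (star u * u) * u ^ j"
      by (simp only: power_Suc star_mult mult.assoc)
    then show ?case using Suc u by simp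
  qed simp
  show 2: "u ^ j * star (u ^ j) = 1" for j
  proof (induction j)
    case (Suc j)
    have "u ^ Suc j * star (u ^ Suc j) = u * (u ^ j * star (u ^ j)) * star u"
      by (simp only: power_Suc star_mult mult.assoc)
    then show ?case using Suc u by simp
  qed simp
  show 3: "u ^ j * i a = i ((\<alpha> ^^ j) a) * u ^ j" for j a
  proof (induction j)
    case (Suc j)
    have "u ^ Suc j * i a = u * (u ^ j * i a)" by (simp add: mult.assoc)
    also have "\<dots> = u * i ((\<alpha> ^^ j) a) * u ^ j" by (simp add: Suc mult.assoc)
    finally show ?case by (simp add: cov mult.assoc)
  qed simp
  show "star (u ^ j) * i a * u ^ j = i ((\<alpha> ^^ (n - j)) a)" if "j \<le> n"
  proof -
    have "u ^ (n - j) = u ^ (n - j) * (u ^ j * star (u ^ j))" by (simp add: 2)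
    also have "\<dots> = star (u ^ j)" using u(3) that by (simp flip: mult.assoc power_add)
    finally have su: "star (u ^ j) = u ^ (n - j)" ..
    have "u ^ (n - j) * u ^ j = 1" using u(3) that by (simp flip: power_add)
    then show ?thesis unfolding su 3 by (simp add: mult.assoc)
  qed
qed

text \<open>In the proof \<open>R j\<close> is the image of a sequence of Rokhlin projections and \<open>Q j = u\<^sup>j P\<close> is, up to an
  error tending to zero, a partial isometry from \<open>P\<close> onto \<open>R j\<close>. Its correction \<open>V j\<close> keeps the
  range below \<open>R j\<close>, so that the ranges for different \<open>j\<close> stay exactly orthogonal.\<close>

lemma AF_algebra_of_covariant_pair:
  fixes \<alpha> :: "'a::cstar_algebra \<Rightarrow> 'a" and i :: "'a \<Rightarrow> 'b::cstar_algebra"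
  assumes n: "n \<ge> 1" and AF: "AF_algebra TYPE('a)" and Rokhlin: "strict_Rokhlin n \<alpha>"
    and i: "star_homomorphism i" "i 1 = 1"
    and u: "star u * u = 1" "u * star u = 1" "u ^ n = 1"
    and cov: "\<And>a. u * i a = i (\<alpha> a) * u"
    and dense: "closure (range (\<lambda>f. \<Sum>k<n. i (f k) * u ^ k)) = UNIV"
  shows "AF_algebra TYPE('b)"
proof -
  have i_add: "i (a + b) = i a + i b" and i_scale: "i (c *\<^sub>C a) = c *\<^sub>C i a"
    and i_mult: "i (a * b) = i a * i b" and i_star: "i (star a) = star (i a)" for a b c
    using i(1) by (auto simp: star_homomorphism_def)
  note i_diff = star_homomorphism_diff[OF i(1)]
  note i_norm = star_homomorphism_contractive[OF i(1)]
  have i_sum: "i (\<Sum>j\<in>J. a j) = (\<Sum>j\<in>J. i (a j))" for a and J :: "nat set"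
    using i_add[of 0 0] by (induction J rule: infinite_finite_induct) (auto simp: i_add)
  have i_proj: "projection (i e)" if "projection e" for e
    using that unfolding projection_def by (metis i_mult i_star)
  have "bounded_linear i"
    by (rule bounded_linear_intro[where K=1])
      (simp_all add: i_add star_homomorphism_scaleR[OF i(1)] i_norm)
  note i_tendsto = bounded_linear.tendsto[OF this]
  note up = covariant_pair_powers[where i = i and \<alpha> = \<alpha>, OF u cov]

  obtain B :: "nat \<Rightarrow> 'a set" where B: "\<And>k. findim_star_subalgebra (B k)" "\<And>k. B k \<subseteq> B (Suc k)"
    "closure (\<Union>k. B k) = UNIV"
    using AF unfolding AF_algebra_def by blast
  have Bmono: "B j \<subseteq> B k" if "j \<le> k" for j k using lift_Suc_mono_le[of B, OF B(2) that] .
  note Bc = closed_star_subalgebraD[OF findim_closed_star_subalgebra[OF B(1)]]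
  have "\<exists>S. finite S \<and> B k = cspan S" for k
    using B(1)[of k] unfolding findim_star_subalgebra_def by blast
  then obtain S where S: "\<And>k. finite (S k)" "\<And>k. B k = cspan (S k)" by metis
  have SB: "s \<in> B k" if "s \<in> S k" for s k using that S(2) complex_space.span_base by blast

  define rokhlin where "rokhlin m e \<longleftrightarrow> (\<forall>j<n. projection (e j)) \<and>
      (\<forall>i<n. \<forall>j<n. i \<noteq> j \<longrightarrow> e i * e j = 0) \<and>
      (\<forall>j. j + 1 < n \<longrightarrow> norm (\<alpha> (e j) - e (j + 1)) < inverse (real (Suc m))) \<and>
      (\<forall>j<n. \<forall>a\<in>(\<Union>k\<le>m. S k). norm (e j * a - a * e j) < inverse (real (Suc m))) \<and>
      (\<Sum>j<n. e j) = 1" for m and e :: "nat \<Rightarrow> 'a"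
  have "\<exists>e. rokhlin m e" for m
  proof -
    have "finite (\<Union>k\<le>m. S k) \<and> inverse (real (Suc m)) > 0" using S(1) by simp
    from Rokhlin[unfolded strict_Rokhlin_def, THEN spec, THEN spec, THEN mp, OF this]
    show ?thesis unfolding rokhlin_def .
  qed
  then obtain e where "\<And>m. rokhlin m (e m)" by metis
  note e = this[unfolded rokhlin_def]
  have e1: "projection (e m j)" if "j < n" for m j using e[of m] that by blast
  have e2: "e m j * e m l = 0" if "j < n" "l < n" "j \<noteq> l" for m j l using e[of m] that by blast
  have e3: "norm (\<alpha> (e m j) - e m (Suc j)) < inverse (real (Suc m))" if "Suc j < n" for m j
    using e[of m] that by simp
  have e4: "norm (e m j * a - a * e m j) < inverse (real (Suc m))" if "j < n" "a \<in> S k" "k \<le> m" for m j a k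
    using e[of m] that by blast
  have e5: "(\<Sum>j<n. e m j) = 1" for m using e[of m] by blast

  have "\<exists>k q. k \<ge> m \<and> q \<in> B k \<and> projection q \<and> norm (q - e m 0) < inverse (real (Suc m))" for m
    using projection_in_dense_union[OF B e1[of 0 m], of "inverse (real (Suc m))" m] n by auto
  then obtain \<kappa> q where q: "\<And>m. \<kappa> m \<ge> m" "\<And>m. q m \<in> B (\<kappa> m)" "\<And>m. projection (q m)"
    "\<And>m. norm (q m - e m 0) < inverse (real (Suc m))" by metis

  define R where "R j m = i (e m j)" for j m
  define P where "P m = i (q m)" for m
  define Q where "Q j m = u ^ j * P m" for j m
  define X where "X j m = R j m * Q j m" for j m
  define V where "V j m = polar_part (P m) (X j m)" for j m
  have Pp: "projection (P m)" "P m * P m = P m" "star (P m) = P m" for m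
    using i_proj[OF q(3)[of m]] by (auto simp: P_def projection_def)
  have Rp: "projection (R j m)" "R j m * R j m = R j m" "star (R j m) = R j m" if "j < n" for j m
    using i_proj[OF e1[OF that]] by (auto simp: R_def projection_def)
  have Rsum: "(\<Sum>j<n. R j m) = 1" for m by (simp add: R_def e5 i(2) flip: i_sum)
  have QP: "Q j m * P m = Q j m" for j m by (simp add: Q_def mult.assoc Pp)
  have sQ: "star (Q j m) = P m * star (u ^ j)" for j m by (simp add: Q_def star_mult Pp)
  have QQ: "star (Q j m) * Q j m = P m" for j m
  proof -
    have "star (Q j m) * Q j m = P m * (star (u ^ j) * u ^ j) * P m"
      unfolding sQ unfolding Q_def by (simp only: mult.assoc)
    then show ?thesis by (simp add: up(1) Pp)
  qed
  have BP: "Bseq P" by (rule BseqI'[of _ 1]) (rule norm_projection_le_1[OF Pp(1)])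
  have BR: "Bseq (R j)" if "j < n" for j by (rule BseqI'[of _ 1]) (rule norm_projection_le_1[OF Rp(1)[OF that]])
  have BQ: "Bseq (Q j)" for j unfolding Q_def[abs_def] by (intro Bseq_algebra_mult BP Bfun_const)
  have BsQ: "Bseq (\<lambda>m. star (Q j m))" for j unfolding sQ by (intro Bseq_algebra_mult BP Bfun_const)

  have PR: "P \<doteq> R 0"
  proof (rule asymptoticI_norm, rule always_eventually, rule allI)
    fix m
    have "norm (P m - R 0 m) \<le> norm (q m - e m 0)" unfolding P_def R_def i_diff[symmetric] by (rule i_norm)
    then show "norm (P m - R 0 m) \<le> inverse (real (Suc m))" using q(4)[of m] by linarith
  qed
  have QQR: "(\<lambda>m. Q j m * star (Q j m)) \<doteq> R j" if "j < n" for j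
    using that
  proof (induction j)
    case 0
    then show ?case using PR by (simp add: Q_def Pp)
  next
    case (Suc j)
    have "(\<lambda>m. Q (Suc j) m * star (Q (Suc j) m)) = (\<lambda>m. u * (Q j m * star (Q j m)) * star u)"
      unfolding Q_def by (simp add: star_mult mult.assoc)
    also have "\<dots> \<doteq> (\<lambda>m. u * R j m * star u)"
      using Suc by (intro asymptotic_mult_const) simp
    also have "(\<lambda>m. u * R j m * star u) = (\<lambda>m. i (\<alpha> (e m j)))"
      by (simp add: R_def cov mult.assoc u(2))
    also have "\<dots> \<doteq> R (Suc j)"
    proof (rule asymptoticI_norm, rule always_eventually, rule allI)
      fix m
      have "norm (i (\<alpha> (e m j)) - R (Suc j) m) \<le> norm (\<alpha> (e m j) - e m (Suc j))"
        unfolding R_def i_diff[symmetric] by (rule i_norm)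
      then show "norm (i (\<alpha> (e m j)) - R (Suc j) m) \<le> inverse (real (Suc m))"
        using e3[OF Suc.prems, of m] by linarith
    qed
    finally show ?case .
  qed
  have XQ: "X j \<doteq> Q j" if "j < n" for j
  proof -
    have "X j \<doteq> (\<lambda>m. Q j m * star (Q j m) * Q j m)"
      unfolding X_def[abs_def] using asymptotic_sym[OF QQR[OF that]] BR[OF that] BQ
      by (intro asymptotic_mult asymptotic_refl) auto
    also have "\<dots> = Q j" by (simp add: mult.assoc QQ QP)
    finally show ?thesis .
  qed
  have BX: "Bseq (X j)" if "j < n" for j using asymptotic_Bseq[OF XQ[OF that] BQ] .
  have BsX: "Bseq (\<lambda>m. star (X j m))" if "j < n" for j
    using asymptotic_Bseq[OF asymptotic_star[OF XQ[OF that]] BsQ] .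
  have z: "(\<lambda>m. P m - star (X j m) * X j m) \<longlonglongrightarrow> 0" if "j < n" for j
  proof -
    have "(\<lambda>m. star (X j m) * X j m) \<doteq> (\<lambda>m. star (Q j m) * Q j m)"
      by (rule asymptotic_mult[OF asymptotic_star[OF XQ[OF that]] XQ[OF that] BsX[OF that] BQ])
    then have "P \<doteq> (\<lambda>m. star (X j m) * X j m)" unfolding QQ by (rule asymptotic_sym)
    then show ?thesis by (simp add: asymptotic_def)
  qed
  have VQ: "V j \<doteq> Q j" if "j < n" for j
  proof -
    have "(\<lambda>m. inv_sqrt (P m - star (X j m) * X j m)) \<doteq> (\<lambda>m. 1)"
      using inv_sqrt_tendsto_1[OF z[OF that]] by (simp add: asymptotic_def LIM_zero)
    then have "V j \<doteq> (\<lambda>m. X j m * 1)"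
      unfolding V_def[abs_def] polar_part_def by (intro asymptotic_mult asymptotic_refl BX that) auto
    also have "\<dots> \<doteq> Q j" using XQ[OF that] by simp
    finally show ?thesis .
  qed

  let ?good = "\<lambda>m. \<forall>j\<in>{..<n}. norm (P m - star (X j m) * X j m) < 1"
  have good: "\<forall>\<^sub>F m in sequentially. ?good m"
  proof (rule eventually_ball_finite)
    show "\<forall>j\<in>{..<n}. \<forall>\<^sub>F m in sequentially. norm (P m - star (X j m) * X j m) < 1"
      using order_tendstoD(2)[OF tendsto_norm_zero[OF z], of _ 1] by simp
  qed simp
  have XP: "X j m * P m = X j m" for j m by (simp add: X_def mult.assoc QP)
  have VV: "star (V j m) * V j m = P m" if "?good m" "j < n" for j m
    unfolding V_def using that by (intro polar_part_isometry Pp XP) simp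
  have RV: "R j m * V j m = V j m" if "j < n" for j m
    unfolding V_def polar_part_def X_def using Rp(2)[OF that, of m] by (simp flip: mult.assoc)
  have V0: "star (V j m) * V l m = 0" if "j < n" "l < n" "j \<noteq> l" for j l m
  proof -
    have "star (V j m) * V l m = star (R j m * V j m) * (R l m * V l m)" using RV that by simp
    also have "\<dots> = star (V j m) * (R j m * R l m) * V l m"
      by (simp add: star_mult Rp(3)[OF that(1)] mult.assoc)
    also have "R j m * R l m = i (e m j * e m l)" by (simp add: R_def i_mult)
    also have "\<dots> = 0" using e2[OF that] i_scale[of 0 0] by simp
    finally show ?thesis by simp
  qed

  define T where "T m = (\<Union>j<n. \<Union>l<n. (\<lambda>s. V j m * i s * star (V l m)) ` S (\<kappa> m))" for m
  \<comment> \<open>For the finitely many indices at which the polar parts are not yet partial isometries the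
    zero algebra serves as a default.\<close>
  define E where "E m = (if ?good m then cspan (T m) else {0})" for m
  have gen: "V j m * i b * star (V l m) \<in> cspan (T m)" if jl: "j < n" "l < n" and b: "b \<in> B (\<kappa> m)" for j l m b
  proof -
    have "cspan (S (\<kappa> m)) \<subseteq> {b. V j m * i b * star (V l m) \<in> cspan (T m)}"
    proof (rule complex_space.span_minimal)
      show "S (\<kappa> m) \<subseteq> {b. V j m * i b * star (V l m) \<in> cspan (T m)}"
        using jl by (auto simp: T_def intro!: complex_space.span_base)
      show "csubspace {b. V j m * i b * star (V l m) \<in> cspan (T m)}"
        by (rule csubspace_vimage[OF complex_space.subspace_span])
          (simp_all add: i_add i_scale distrib_left distrib_right mult_scaleC_left mult_scaleC_right)
    qed
    then show ?thesis using b S(2) by blast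
  qed
  have Tcases: "\<exists>j<n. \<exists>l<n. \<exists>s\<in>S (\<kappa> m). x = V j m * i s * star (V l m)" if "x \<in> T m" for x m
    using that by (auto simp: T_def)
  have Efd: "findim_star_subalgebra (E m)" for m
  proof (cases "?good m")
    case True
    have "findim_star_subalgebra (cspan (T m))"
    proof (rule findim_star_subalgebra_cspan)
      show "finite (T m)" unfolding T_def using S(1) by auto
      show "star x \<in> cspan (T m)" if x: "x \<in> T m" for x
      proof -
        obtain j l s where x: "j < n" "l < n" "s \<in> S (\<kappa> m)" "x = V j m * i s * star (V l m)"
          using Tcases[OF x] by blast
        have "star x = V l m * i (star s) * star (V j m)"
          by (simp add: x(4) star_mult star_star i_star mult.assoc)
        then show ?thesis using gen[OF x(2,1) Bc(5)[OF SB[OF x(3)]]] by simp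
      qed
      show "x * y \<in> cspan (T m)" if xy: "x \<in> T m" "y \<in> T m" for x y
      proof -
        obtain j l s where x: "j < n" "l < n" "s \<in> S (\<kappa> m)" "x = V j m * i s * star (V l m)"
          using Tcases[OF xy(1)] by blast
        obtain j' l' t where y: "j' < n" "l' < n" "t \<in> S (\<kappa> m)" "y = V j' m * i t * star (V l' m)"
          using Tcases[OF xy(2)] by blast
        have eq: "x * y = V j m * i s * (star (V l m) * V j' m) * i t * star (V l' m)"
          unfolding x(4) y(4) by (simp only: mult.assoc)
        show ?thesis
        proof (cases "l = j'")
          case True
          then have "x * y = V j m * i (s * q m * t) * star (V l' m)"
            unfolding eq using VV[OF \<open>?good m\<close> x(2)] by (simp add: P_def i_mult mult.assoc)
          moreover have "s * q m * t \<in> B (\<kappa> m)" by (intro Bc(4) SB x y q)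
          ultimately show ?thesis using gen x(1) y(2) by simp
        next
          case False
          then show ?thesis unfolding eq using V0[OF x(2) y(1)] by (simp add: complex_space.span_zero)
        qed
      qed
    qed
    then show ?thesis using True by (simp add: E_def)
  next
    case False
    then show ?thesis unfolding E_def using findim_star_subalgebra_zero by (simp only: if_False)
  qed
  note Ec = findim_closed_star_subalgebra[OF Efd]
  have E0: "0 \<in> E m" for m by (rule closed_star_subalgebraD(1)[OF Ec])
  have genE: "\<forall>\<^sub>F m in sequentially. (\<Sum>j<n. V (\<sigma> j) m * i (b j m) * star (V j m)) \<in> E m"
    if "\<And>j. j < n \<Longrightarrow> \<sigma> j < n" "\<And>j m. j < n \<Longrightarrow> b j m \<in> B (\<kappa> m)" for \<sigma> b
    using good
  proof eventually_elim
    case (elim m)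
    have "(\<Sum>j<n. V (\<sigma> j) m * i (b j m) * star (V j m)) \<in> cspan (T m)"
      using gen that by (intro complex_space.span_sum) auto
    then show ?case using elim by (simp add: E_def)
  qed
  note L = closed_star_subalgebraD[OF closed_star_subalgebra_lower_limit[OF Ec]]
  have Lcl: "closed (lower_limit E)" "csubspace (lower_limit E)"
    using closed_star_subalgebra_lower_limit[OF Ec] by (auto simp: closed_star_subalgebra_def)

  \<comment> \<open>As \<open>\<kappa> m \<ge> m\<close>, the algebras \<open>B (\<kappa> m)\<close> still exhaust the given AF algebra.\<close>
  have "a \<in> lower_limit (\<lambda>m. B (\<kappa> m))" for a
  proof -
    have "b \<in> lower_limit (\<lambda>m. B (\<kappa> m))" if "b \<in> B k" for b k
    proof (rule lower_limitI_eventually)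
      show "\<forall>\<^sub>F m in sequentially. b \<in> B (\<kappa> m)"
        using eventually_ge_at_top[of k]
      proof eventually_elim
        case (elim m)
        then show ?case using Bmono[of k "\<kappa> m"] q(1)[of m] that by auto
      qed
    qed (auto simp: Bc(1))
    then have "(\<Union>k. B k) \<subseteq> lower_limit (\<lambda>m. B (\<kappa> m))" by blast
    moreover have "closed (lower_limit (\<lambda>m. B (\<kappa> m)))"
      using closed_star_subalgebra_lower_limit[of "\<lambda>m. B (\<kappa> m)"] findim_closed_star_subalgebra[OF B(1)]
      by (auto simp: closed_star_subalgebra_def)
    ultimately have "closure (\<Union>k. B k) \<subseteq> lower_limit (\<lambda>m. B (\<kappa> m))" by (rule closure_minimal)
    then show ?thesis using B(3) by blast
  qed
  then have "\<exists>\<beta>. (\<forall>m. \<beta> m \<in> B (\<kappa> m)) \<and> \<beta> \<longlonglongrightarrow> a" for a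
    unfolding lower_limit_def by blast
  then obtain \<beta> where \<beta>: "\<And>a m. \<beta> a m \<in> B (\<kappa> m)" "\<And>a. \<beta> a \<longlonglongrightarrow> a" by metis

  have iS: "i a \<in> lower_limit E" if a: "a \<in> S k" for a k
  proof -
    define b where "b j = \<beta> ((\<alpha> ^^ (n - j)) a)" for j
    \<comment> \<open>The corner of \<open>a\<close> at \<open>R j\<close> is approximately the conjugate by \<open>u\<^sup>j\<close> of the corner of
      \<open>(u\<^sup>j)\<^sup>* a u\<^sup>j\<close> at \<open>P\<close>. As \<open>u\<^sup>n = 1\<close>, the adjoint of \<open>u\<^sup>j\<close> is \<open>u\<^sup>n\<^sup>-\<^sup>j\<close>, so the covariance relation
      makes this an element of the image of \<open>i\<close>.\<close>
    have corner: "(\<lambda>m. R j m * i a) \<doteq> (\<lambda>m. V j m * i (b j m) * star (V j m))" if j: "j < n" for j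
    proof -
      let ?a = "i ((\<alpha> ^^ (n - j)) a)"
      have comm: "(\<lambda>m. R j m * i a) \<doteq> (\<lambda>m. i a * R j m)"
      proof (rule asymptoticI_norm)
        show "\<forall>\<^sub>F m in sequentially. norm (R j m * i a - i a * R j m) \<le> inverse (real (Suc m))"
          using eventually_ge_at_top[of k]
        proof eventually_elim
          case (elim m)
          have "norm (R j m * i a - i a * R j m) \<le> norm (e m j * a - a * e m j)"
            unfolding R_def i_mult[symmetric] i_diff[symmetric] by (rule i_norm)
          then show ?case using e4[OF j a elim] by linarith
        qed
      qed
      have BRa: "Bseq (\<lambda>m. R j m * i a)" "Bseq (\<lambda>m. i a * R j m)"
        using BR[OF j] by (auto intro: Bseq_algebra_mult)
      have bt: "(\<lambda>m. i (b j m)) \<doteq> (\<lambda>m. ?a)" "Bseq (\<lambda>m. i (b j m))"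
      proof -
        have "(\<lambda>m. i (b j m)) \<longlonglongrightarrow> ?a" unfolding b_def by (intro i_tendsto \<beta>(2))
        then show "(\<lambda>m. i (b j m)) \<doteq> (\<lambda>m. ?a)" "Bseq (\<lambda>m. i (b j m))"
          by (auto simp: asymptotic_def LIM_zero intro!: convergent_imp_Bseq convergentI)
      qed
      have "(\<lambda>m. R j m * i a) = (\<lambda>m. R j m * (R j m * i a))"
        by (simp add: Rp(2)[OF j] flip: mult.assoc)
      also have "\<dots> \<doteq> (\<lambda>m. R j m * (i a * R j m))"
        by (intro asymptotic_mult asymptotic_refl comm BR[OF j] BRa)
      also have "\<dots> = (\<lambda>m. R j m * i a * R j m)" by (simp add: mult.assoc)
      also have "\<dots> \<doteq> (\<lambda>m. Q j m * star (Q j m) * i a * (Q j m * star (Q j m)))"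
        by (intro asymptotic_mult asymptotic_refl asymptotic_sym[OF QQR[OF j]] BRa BR[OF j]
            Bseq_algebra_mult BQ BsQ Bfun_const)
      also have "\<dots> = (\<lambda>m. Q j m * ?a * star (Q j m))"
      proof
        fix m
        have "Q j m * star (Q j m) * i a * (Q j m * star (Q j m))
            = Q j m * P m * (star (u ^ j) * i a * u ^ j) * (P m * star (Q j m))"
          unfolding sQ[of j m] unfolding Q_def by (simp only: mult.assoc)
        also have "\<dots> = Q j m * ?a * star (Q j m)"
          using up(4)[of j a] j QP by (simp add: sQ Pp flip: mult.assoc)
        finally show "Q j m * star (Q j m) * i a * (Q j m * star (Q j m)) = Q j m * ?a * star (Q j m)" .
      qed
      also have "\<dots> \<doteq> (\<lambda>m. V j m * i (b j m) * star (V j m))"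
        using asymptotic_sym[OF VQ[OF j]] asymptotic_sym[OF asymptotic_star[OF VQ[OF j]]]
          asymptotic_sym[OF bt(1)] bt(2) BQ BsQ asymptotic_Bseq[OF asymptotic_star[OF VQ[OF j]] BsQ]
        by (intro asymptotic_mult Bseq_algebra_mult Bfun_const) auto
      finally show ?thesis .
    qed
    have "(\<lambda>m. \<Sum>j<n. R j m * i a) \<doteq> (\<lambda>m. \<Sum>j<n. V j m * i (b j m) * star (V j m))"
      by (rule asymptotic_sum) (simp add: corner)
    then have "(\<lambda>m. i a) \<doteq> (\<lambda>m. \<Sum>j<n. V j m * i (b j m) * star (V j m))"
      by (simp add: Rsum flip: sum_distrib_right)
    then have "(\<lambda>m. \<Sum>j<n. V j m * i (b j m) * star (V j m)) \<longlonglongrightarrow> i a"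
      by (rule asymptotic_tendsto[OF asymptotic_sym tendsto_const])
    moreover have "\<forall>\<^sub>F m in sequentially. (\<Sum>j<n. V j m * i (b j m) * star (V j m)) \<in> E m"
      by (rule genE) (auto simp: b_def \<beta>(1))
    ultimately show ?thesis by (rule lower_limitI_eventually[OF _ _ E0, rotated])
  qed
  have iL: "i a \<in> lower_limit E" for a
  proof -
    have cs: "csubspace {a. i a \<in> lower_limit E}"
      by (rule csubspace_vimage[OF Lcl(2)]) (simp_all add: i_add i_scale)
    have "B k \<subseteq> {a. i a \<in> lower_limit E}" for k
      unfolding S(2) using iS by (intro complex_space.span_minimal[OF _ cs]) blast
    then have "(\<Union>k. B k) \<subseteq> {a. i a \<in> lower_limit E}" by blast
    moreover have "closed {a. i a \<in> lower_limit E}"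
      using continuous_closed_vimage[OF Lcl(1), of i] linear_continuous_at[OF \<open>bounded_linear i\<close>]
      by (simp add: vimage_def)
    ultimately have "closure (\<Union>k. B k) \<subseteq> {a. i a \<in> lower_limit E}" by (rule closure_minimal)
    then show ?thesis using B(3) by blast
  qed

  have uL: "u \<in> lower_limit E"
  proof -
    \<comment> \<open>Up to small errors \<open>u\<close> maps the range of \<open>V j\<close> onto the range of the next one, and the
      relation \<open>u\<^sup>n = 1\<close> closes the cycle.\<close>
    let ?\<sigma> = "\<lambda>j. Suc j mod n"
    have \<sigma>: "?\<sigma> j < n" for j using n by simp
    have "(\<lambda>m. u * R j m * 1) \<doteq> (\<lambda>m. V (?\<sigma> j) m * i (q m) * star (V j m))" if j: "j < n" for j
    proof -
      have u\<sigma>: "u ^ ?\<sigma> j = u * u ^ j"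
      proof (cases "Suc j = n")
        case True
        then show ?thesis using u(3) by (metis mod_self power_0 power_Suc)
      next
        case False
        then show ?thesis using j by simp
      qed
      have "(\<lambda>m. u * R j m * 1) \<doteq> (\<lambda>m. u * (Q j m * star (Q j m)) * 1)"
        by (rule asymptotic_mult_const[OF asymptotic_sym[OF QQR[OF j]]])
      also have "\<dots> = (\<lambda>m. Q (?\<sigma> j) m * P m * star (Q j m))"
        unfolding Q_def u\<sigma> by (simp add: mult.assoc star_mult Pp)
      also have "\<dots> \<doteq> (\<lambda>m. V (?\<sigma> j) m * P m * star (V j m))"
        using asymptotic_sym[OF VQ[OF \<sigma>, of j]] asymptotic_sym[OF asymptotic_star[OF VQ[OF j]]]
          BP BQ asymptotic_Bseq[OF asymptotic_star[OF VQ[OF j]] BsQ]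
        by (intro asymptotic_mult Bseq_algebra_mult asymptotic_refl) auto
      finally show ?thesis by (simp add: P_def)
    qed
    then have "(\<lambda>m. \<Sum>j<n. u * R j m * 1) \<doteq> (\<lambda>m. \<Sum>j<n. V (?\<sigma> j) m * i (q m) * star (V j m))"
      by (intro asymptotic_sum) simp
    then have "(\<lambda>m. u) \<doteq> (\<lambda>m. \<Sum>j<n. V (?\<sigma> j) m * i (q m) * star (V j m))"
      by (simp add: Rsum flip: sum_distrib_left)
    then have "(\<lambda>m. \<Sum>j<n. V (?\<sigma> j) m * i (q m) * star (V j m)) \<longlonglongrightarrow> u"
      by (rule asymptotic_tendsto[OF asymptotic_sym tendsto_const])
    moreover have "\<forall>\<^sub>F m in sequentially. (\<Sum>j<n. V (?\<sigma> j) m * i (q m) * star (V j m)) \<in> E m"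
      by (rule genE) (auto simp: \<sigma> q(2))
    ultimately show ?thesis by (rule lower_limitI_eventually[OF _ _ E0, rotated])
  qed
  have ukL: "u ^ k \<in> lower_limit E" for k
    by (induction k) (use iL[of 1] i(2) L(4) uL in auto)
  have "range (\<lambda>f. \<Sum>k<n. i (f k) * u ^ k) \<subseteq> lower_limit E"
    by (auto intro!: L(8) L(4) iL ukL)
  then have "closure (range (\<lambda>f. \<Sum>k<n. i (f k) * u ^ k)) \<subseteq> lower_limit E"
    using Lcl(1) by (rule closure_minimal)
  then have "lower_limit E = UNIV" using dense by auto
  then show ?thesis by (rule AF_algebra_if_asymptotically_exhausted[OF Efd])
qed


section \<open>The crossed product\<close>

definition point_mass :: "nat \<Rightarrow> 'a::zero \<Rightarrow> nat \<Rightarrow> 'a" where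
  "point_mass k a = (\<lambda>m. if m = k then a else 0)"

lemma point_mass_mem: "k < n \<Longrightarrow> point_mass k a \<in> group_functions n"
  by (auto simp: point_mass_def group_functions_def)

context
  fixes \<alpha> :: "'a::cstar_algebra \<Rightarrow> 'a"
  assumes \<alpha>: "star_automorphism \<alpha>"
begin

lemma automorphism_power_zero: "(\<alpha> ^^ k) 0 = 0"
proof (induction k)
  case (Suc k)
  have "\<alpha> (0 + 0) = \<alpha> 0 + \<alpha> 0" using \<alpha> unfolding star_automorphism_def by blast
  then show ?case using Suc by simp
qed simp

lemma automorphism_power_one: "(\<alpha> ^^ k) 1 = 1"
proof (induction k)
  case (Suc k)
  have "surj \<alpha>" using \<alpha> by (simp add: star_automorphism_def bij_is_surj)
  then obtain a where "\<alpha> a = 1" by (metis surjD)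
  moreover have "\<alpha> (1 * a) = \<alpha> 1 * \<alpha> a" using \<alpha> unfolding star_automorphism_def by blast
  ultimately show ?case using Suc by simp
qed simp

lemma twisted_mult_point_mass_left:
  assumes "k < n"
  shows "twisted_mult n \<alpha> (point_mass k a) f = (\<lambda>m. if m < n then a * (\<alpha> ^^ k) (f ((m + n - k) mod n)) else 0)"
proof
  fix m
  have "(\<Sum>i<n. point_mass k a i * (\<alpha> ^^ i) (f ((m + n - i) mod n)))
      = (\<Sum>i<n. if i = k then a * (\<alpha> ^^ k) (f ((m + n - k) mod n)) else 0)"
    by (intro sum.cong) (auto simp: point_mass_def)
  then show "twisted_mult n \<alpha> (point_mass k a) f m = (if m < n then a * (\<alpha> ^^ k) (f ((m + n - k) mod n)) else 0)"
    using assms by (simp add: twisted_mult_def)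
qed

lemma twisted_mult_point_mass:
  assumes "k < n" "l < n"
  shows "twisted_mult n \<alpha> (point_mass k a) (point_mass l b) = point_mass ((k + l) mod n) (a * (\<alpha> ^^ k) b)"
proof
  fix m
  have "(m + n - k) mod n = l \<longleftrightarrow> m = (k + l) mod n" if "m < n"
    using assms that by (auto simp: mod_if)
  moreover have "(k + l) mod n < n" using assms by simp
  ultimately show "twisted_mult n \<alpha> (point_mass k a) (point_mass l b) m = point_mass ((k + l) mod n) (a * (\<alpha> ^^ k) b) m"
    unfolding twisted_mult_point_mass_left[OF assms(1)]
    by (auto simp: point_mass_def automorphism_power_zero)
qed

lemma twisted_star_point_mass:
  assumes "k < n"
  shows "twisted_star n \<alpha> (point_mass k a) = point_mass ((n - k) mod n) ((\<alpha> ^^ ((n - k) mod n)) (star a))"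
proof
  fix m
  have "(n - m) mod n = k \<longleftrightarrow> m = (n - k) mod n" if "m < n"
    using assms that by (auto simp: mod_if)
  moreover have "(n - k) mod n < n" using assms by simp
  ultimately show "twisted_star n \<alpha> (point_mass k a) m = point_mass ((n - k) mod n) ((\<alpha> ^^ ((n - k) mod n)) (star a)) m"
    by (auto simp: twisted_star_def point_mass_def automorphism_power_zero)
qed

end

text \<open>Multiplication of point masses is the relation \<open>a u\<^sup>k b u\<^sup>l = a \<alpha>\<^sup>k(b) u\<^sup>k\<^sup>+\<^sup>l\<close>, and every function on the
  group is the sum of its point masses. The image of the point mass at the neutral element is a
  left unit on a dense subset, hence the unit.\<close>

lemma crossed_product_covariant_pair:
  fixes \<alpha> :: "'a::cstar_algebra \<Rightarrow> 'a" and \<iota> :: "(nat \<Rightarrow> 'a) \<Rightarrow> 'b::cstar_algebra"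
  assumes n: "n \<ge> 1" and \<alpha>: "star_automorphism \<alpha>" "\<alpha> ^^ n = id" and "is_crossed_product n \<alpha> \<iota>"
  defines "i \<equiv> \<lambda>a. \<iota> (point_mass 0 a)" and "u \<equiv> \<iota> (point_mass (1 mod n) 1)"
  shows "star_homomorphism i" "i 1 = 1" "star u * u = 1" "u * star u = 1" "u ^ n = 1"
    "\<And>a. u * i a = i (\<alpha> a) * u"
    "closure (range (\<lambda>f. \<Sum>k<n. i (f k) * u ^ k)) = UNIV"
proof -
  have add: "\<iota> (\<lambda>k. f k + g k) = \<iota> f + \<iota> g" and scale: "\<iota> (\<lambda>k. c *\<^sub>C f k) = c *\<^sub>C \<iota> f"
    and mult: "\<iota> (twisted_mult n \<alpha> f g) = \<iota> f * \<iota> g" and st: "\<iota> (twisted_star n \<alpha> f) = star (\<iota> f)"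
    if "f \<in> group_functions n" "g \<in> group_functions n" for f g c
    using assms(4) that unfolding is_crossed_product_def by blast+
  have cl: "closure (\<iota> ` group_functions n) = UNIV"
    using assms(4) unfolding is_crossed_product_def by blast
  have n0: "0 < n" and n1: "1 mod n < n" using n by auto
  note mem0 = point_mass_mem[OF n0]
  have mult_point_mass: "\<iota> (point_mass k a) * \<iota> (point_mass l b) = \<iota> (point_mass ((k + l) mod n) (a * (\<alpha> ^^ k) b))"
    if "k < n" "l < n" for k l a b
    using mult[OF point_mass_mem point_mass_mem] twisted_mult_point_mass[OF \<alpha>(1)] that by metis
  have star_point_mass: "star (\<iota> (point_mass k a)) = \<iota> (point_mass ((n - k) mod n) ((\<alpha> ^^ ((n - k) mod n)) (star a)))"
    if "k < n" for k a
    using st[OF point_mass_mem point_mass_mem] twisted_star_point_mass[OF \<alpha>(1)] that by metis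

  show i: "star_homomorphism i"
    unfolding star_homomorphism_def
  proof (intro conjI allI)
    fix a b :: 'a and c :: complex
    have "point_mass 0 (a + b) = (\<lambda>k. point_mass 0 a k + point_mass 0 b k)" by (simp add: point_mass_def fun_eq_iff)
    then show "i (a + b) = i a + i b" using add[OF mem0 mem0] by (simp add: i_def)
    have "point_mass 0 (c *\<^sub>C a) = (\<lambda>k. c *\<^sub>C point_mass 0 a k)" by (simp add: point_mass_def fun_eq_iff)
    then show "i (c *\<^sub>C a) = c *\<^sub>C i a" using scale[OF mem0 mem0] by (simp add: i_def)
    show "i (a * b) = i a * i b" using mult_point_mass[OF n0 n0] by (simp add: i_def)
    show "i (star a) = star (i a)" using star_point_mass[OF n0] by (simp add: i_def)
  qed

  have one_left: "i 1 * x = x" for x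
  proof -
    have "\<iota> ` group_functions n \<subseteq> {x. i 1 * x = x}"
    proof clarify
      fix f :: "nat \<Rightarrow> 'a" assume f: "f \<in> group_functions n"
      have "twisted_mult n \<alpha> (point_mass 0 1) f = f"
        unfolding twisted_mult_point_mass_left[OF \<alpha>(1) n0] using f by (auto simp: group_functions_def)
      then show "i 1 * \<iota> f = \<iota> f" using mult[OF mem0 f, of 1] by (simp add: i_def)
    qed
    moreover have "closed {x. i 1 * x = x}" by (intro closed_Collect_eq continuous_intros)
    ultimately have "closure (\<iota> ` group_functions n) \<subseteq> {x. i 1 * x = x}" by (rule closure_minimal)
    then show ?thesis using cl by blast
  qed
  from one_left[of 1] show i1: "i 1 = 1" by simp

  have su: "star u = \<iota> (point_mass ((n - 1 mod n) mod n) 1)"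
    unfolding u_def star_point_mass[OF n1] by (simp add: automorphism_power_one[OF \<alpha>(1)])
  have m: "((n - 1 mod n) mod n + 1 mod n) mod n = 0"
    using n by (cases "n = 1") (auto simp: mod_simps)
  show "star u * u = 1"
    using i1 unfolding su unfolding u_def using n0 n1
    by (simp add: mult_point_mass automorphism_power_one[OF \<alpha>(1)] m i_def)
  have m': "(1 mod n + (n - 1 mod n) mod n) mod n = 0" using m by (simp only: add.commute)
  show "u * star u = 1"
    using i1 unfolding su unfolding u_def using n0 n1
    by (simp add: mult_point_mass automorphism_power_one[OF \<alpha>(1)] m' i_def)
  \<comment> \<open>The exponent is reduced modulo \<open>n\<close>, which also covers the trivial group, where \<open>u = 1\<close>.\<close>
  have upow: "u ^ k = \<iota> (point_mass (k mod n) 1)" for k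
  proof (induction k)
    case 0
    then show ?case using i1 by (simp add: i_def)
  next
    case (Suc k)
    have "u ^ Suc k = \<iota> (point_mass (1 mod n) 1) * \<iota> (point_mass (k mod n) 1)"
      unfolding power_Suc Suc unfolding u_def ..
    also have "\<dots> = \<iota> (point_mass ((1 mod n + k mod n) mod n) 1)"
      using n0 by (simp add: mult_point_mass automorphism_power_one[OF \<alpha>(1)])
    also have "(1 mod n + k mod n) mod n = Suc k mod n" by (simp add: mod_simps)
    finally show ?case .
  qed
  show "u ^ n = 1" using i1 by (simp add: upow i_def)
  show "u * i a = i (\<alpha> a) * u" for a
  proof -
    have "(\<alpha> ^^ (1 mod n)) a = \<alpha> a" using \<alpha>(2) n by (cases "n = 1") auto
    then show ?thesis unfolding i_def u_def using n0 n1 by (simp add: mult_point_mass)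
  qed

  have "\<iota> f = (\<Sum>k<n. i (f k) * u ^ k)" if f: "f \<in> group_functions n" for f
  proof -
    have z: "\<iota> (\<lambda>_. 0) = 0" using scale[OF f f, of 0] by simp
    have "(\<lambda>m. \<Sum>k<N. point_mass k (f k) m) \<in> group_functions n \<and>
        \<iota> (\<lambda>m. \<Sum>k<N. point_mass k (f k) m) = (\<Sum>k<N. \<iota> (point_mass k (f k)))" if "N \<le> n" for N
      using that
    proof (induction N)
      case 0
      then show ?case by (simp add: z group_functions_def)
    next
      case (Suc N)
      then have IH: "(\<lambda>m. \<Sum>k<N. point_mass k (f k) m) \<in> group_functions n"
        "\<iota> (\<lambda>m. \<Sum>k<N. point_mass k (f k) m) = (\<Sum>k<N. \<iota> (point_mass k (f k)))" by auto
      have s: "point_mass N (f N) \<in> group_functions n" using Suc.prems by (intro point_mass_mem) simp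
      show ?case using add[OF IH(1) s] IH s by (simp add: group_functions_def)
    qed
    from this[of n] have "\<iota> (\<lambda>m. \<Sum>k<n. point_mass k (f k) m) = (\<Sum>k<n. \<iota> (point_mass k (f k)))" by simp
    moreover have "(\<lambda>m. \<Sum>k<n. point_mass k (f k) m) = f"
    proof
      fix m
      have "(\<Sum>k<n. point_mass k (f k) m) = (\<Sum>k<n. if k = m then f m else 0)"
        by (intro sum.cong) (auto simp: point_mass_def)
      then show "(\<Sum>k<n. point_mass k (f k) m) = f m" using f by (simp add: group_functions_def)
    qed
    moreover have "\<iota> (point_mass k (f k)) = i (f k) * u ^ k" if "k < n" for k
      unfolding i_def upow using that n0 by (simp add: mult_point_mass)
    ultimately show ?thesis by simp
  qed
  then have "\<iota> ` group_functions n \<subseteq> range (\<lambda>f. \<Sum>k<n. i (f k) * u ^ k)" by blast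
  then have "closure (\<iota> ` group_functions n) \<subseteq> closure (range (\<lambda>f. \<Sum>k<n. i (f k) * u ^ k))"
    by (rule closure_mono)
  then show "closure (range (\<lambda>f. \<Sum>k<n. i (f k) * u ^ k)) = UNIV" using cl by blast
qed

theorem theorem11p2:
  fixes n :: nat
    and \<alpha> :: "'a::cstar_algebra \<Rightarrow> 'a"
    and \<iota> :: "(nat \<Rightarrow> 'a) \<Rightarrow> 'b::cstar_algebra"
  assumes "n \<ge> 1"
    and "AF_algebra TYPE('a)"
    and "star_automorphism \<alpha>"
    and "\<alpha> ^^ n = id"
    and "strict_Rokhlin n \<alpha>"
    and "is_crossed_product n \<alpha> \<iota>"
  shows "AF_algebra TYPE('b)"
proof -
  note pair = crossed_product_covariant_pair[OF assms(1,3,4,6)]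
  show ?thesis by (rule AF_algebra_of_covariant_pair[OF assms(1,2,5) pair])
qed

end
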